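(* Let $1<p<\infty$, $p\neq2$, $1/p+1/q=1$, $-1<\alpha<\infty$. Let $k\in\Lambda^*_{\beta,A^q_\alpha}$ be not identically zero, let $\phi(f)=\int_{\mathbb{D}}f\overline{k}\,dA_\alpha$ on $A^p_\alpha$, let $F$ be the extremal function for $\phi$, and let $F_n$ be the extremal polynomial of degree $n$ for $\phi$, when the problem is posed over polynomials of degree at most $n$. Then $$\|F-F_n\|_{p,\alpha}=O(n^{-\beta/4})\ \text{ if } p<2,\qquad \|F-F_n\|_{p,\alpha}=O(n^{-\beta/p^2})\ \text{ if } p>2.$$ More precisely: (i) for $p<2$ and $0<\beta<2$, $\ \|F-F_n\|_{p,\alpha}\le 4(p-1)^{-3/4}A_{\beta/2}^{1/2}\,\|k\|_{\Lambda^*,\beta,A^q_\alpha}^{1/4}\,n^{-\beta/4}$; (ii) for $p<2$ and $\beta=2$, $\ \|F-F_n\|_{p,\alpha}\le 4(p-1)^{-3/4}\widetilde{B}_0^{1/2}\,\|k\|_{\Lambda^*,\beta,A^q_\alpha}^{1/4}\,n^{-\beta/4}$; (iii) for $p>2$ and $0<\beta\le2$, $\ \|F-F_n\|_{p,\alpha}\le 2^{1+1/p-1/p^2}\,p^{1/p+1/p^2}\,A_{\beta/p}^{1/p}\,\|k\|_{\Lambda^*,\beta,A^q_\alpha}^{1/p^2}\,n^{-\beta/p^2}$.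
   Context: $\mathbb{D}$ is the open unit disc. For $1<p<\infty$, $\alpha>-1$, the weighted Bergman space $A^p_\alpha$ is the space of analytic functions $f$ in $\mathbb{D}$ with $\|f\|_{p,\alpha}=\left(\int_{\mathbb{D}}|f|^p\,dA_\alpha\right)^{1/p}<\infty$, where $dA_\alpha=(\alpha+1)\pi^{-1}(1-|z|^2)^\alpha\,dA(z)$ and $dA$ is Lebesgue area measure. For $k\in A^q_\alpha$ not identically zero, the extremal function for $k$ (or for the functional $\phi(f)=\int_{\mathbb{D}}f\overline{k}\,dA_\alpha$) is the unique $F\in A^p_\alpha$ with $\|F\|_{p,\alpha}=1$ maximizing $\operatorname{Re}\phi(f)$ among all $f\in A^p_\alpha$ of norm $1$. The extremal polynomial $F_n$ maximizes $\operatorname{Re}\phi(f)$ among all polynomials $f$ of degree at most $n$ with $\|f\|_{p,\alpha}=1$. For $g\in A^q_\alpha$ we say $g\in\Lambda^*_{\beta,A^q_\alpha}$ if there is a constant $C$ with $\|g(e^{it}\cdot)+g(e^{-it}\cdot)-2g(\cdot)\|_{q,\alpha}\le C|t|^\beta$; $\|g\|_{\Lambda^*,\beta,A^q_\alpha}$ denotes the infimum of such constants $C$. Constants: for $0<\gamma<1$, $A_\gamma=\frac{2^{1+\gamma}}{\pi}\int_0^\infty|\cos(t)-\cos(2t)|\,t^{\gamma-2}\,dt$. Also $\widetilde{B}_0=C_2/\pi+\pi C_0$, where $C_k=\frac4\pi\int_0^\infty|H_k(t)|\,dt$, $H_0(t)=\frac{\cos(t)-\cos(2t)}{2t^2}$,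 $H_k(t)=\int_t^\infty H_{k-1}(x)\,dx$ for $k\ge1$.
   Formalization: In (i)–(iii) the seminorm of k is divided by the operator norm of φ on the Bergman space (so the bounds are as stated when ‖φ‖=1); as written they fail, since scaling k by small c>0 fixes F and F_n but shrinks the bound to 0 (e.g. k=c(1+z^5), n=1). *)

theory Defs
  imports
    "HOL-Complex_Analysis.Complex_Analysis"
    "HOL-Library.Landau_Symbols"
begin

definition bergman_measure :: "real \<Rightarrow> complex measure" where
  "bergman_measure \<alpha> =
     density (restrict_space lborel (ball 0 1))
       (\<lambda>z. ennreal ((\<alpha> + 1) / pi * (1 - (cmod z)\<^sup>2) powr \<alpha>))"

text \<open>
  Functions on the disc are total functions on the complex plane; their values outside
  the open unit disc are irrelevant everywhere below.  The norm is only meaningful for functions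
  whose \<open>p\<close>-th power is integrable (the Bochner integral of any other function is 0).
\<close>

definition bergman_norm :: "real \<Rightarrow> real \<Rightarrow> (complex \<Rightarrow> complex) \<Rightarrow> real" where
  "bergman_norm p \<alpha> f = (LINT z|bergman_measure \<alpha>. cmod (f z) powr p) powr (1 / p)"

definition bergman_space :: "real \<Rightarrow> real \<Rightarrow> (complex \<Rightarrow> complex) set" where
  "bergman_space p \<alpha> =
     {f. f holomorphic_on ball 0 1 \<and>
         integrable (bergman_measure \<alpha>) (\<lambda>z. cmod (f z) powr p)}"

definition bergman_functional ::
    "real \<Rightarrow> (complex \<Rightarrow> complex) \<Rightarrow> (complex \<Rightarrow> complex) \<Rightarrow> complex" where
  "bergman_functional \<alpha> k f = (LINT z|bergman_measure \<alpha>. f z * cnj (k z))"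

definition bergman_functional_norm :: "real \<Rightarrow> real \<Rightarrow> (complex \<Rightarrow> complex) \<Rightarrow> real" where
  "bergman_functional_norm p \<alpha> k =
     (SUP f \<in> {f \<in> bergman_space p \<alpha>. bergman_norm p \<alpha> f \<le> 1}. cmod (bergman_functional \<alpha> k f))"

text \<open>
  Being a maximiser is a predicate, so uniqueness is not built in.  (If the functional vanishes on
  all polynomials of degree at most \<open>n\<close>, every such polynomial of norm 1 is a maximiser.)
\<close>

definition extremal_in ::
    "(complex \<Rightarrow> complex) set \<Rightarrow> real \<Rightarrow> real \<Rightarrow> (complex \<Rightarrow> complex) \<Rightarrow> (complex \<Rightarrow> complex) \<Rightarrow> bool" where
  "extremal_in S p \<alpha> k F \<longleftrightarrow>
     F \<in> S \<and> bergman_norm p \<alpha> F = 1 \<and>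
     (\<forall>f\<in>S. bergman_norm p \<alpha> f = 1 \<longrightarrow>
        Re (bergman_functional \<alpha> k f) \<le> Re (bergman_functional \<alpha> k F))"

definition extremal_function ::
    "real \<Rightarrow> real \<Rightarrow> (complex \<Rightarrow> complex) \<Rightarrow> (complex \<Rightarrow> complex) \<Rightarrow> bool" where
  "extremal_function p \<alpha> k F \<longleftrightarrow> extremal_in (bergman_space p \<alpha>) p \<alpha> k F"

definition extremal_polynomial ::
    "real \<Rightarrow> real \<Rightarrow> (complex \<Rightarrow> complex) \<Rightarrow> nat \<Rightarrow> (complex \<Rightarrow> complex) \<Rightarrow> bool" where
  "extremal_polynomial p \<alpha> k n F \<longleftrightarrow>
     extremal_in {poly P |P :: complex poly. degree P \<le> n} p \<alpha> k F"

definition zygmund_bound ::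
    "real \<Rightarrow> real \<Rightarrow> real \<Rightarrow> (complex \<Rightarrow> complex) \<Rightarrow> real \<Rightarrow> bool" where
  "zygmund_bound \<beta> q \<alpha> g C \<longleftrightarrow>
     (\<forall>t :: real. bergman_norm q \<alpha> (\<lambda>z. g (cis t * z) + g (cis (- t) * z) - 2 * g z)
                    \<le> C * \<bar>t\<bar> powr \<beta>)"

definition zygmund_class :: "real \<Rightarrow> real \<Rightarrow> real \<Rightarrow> (complex \<Rightarrow> complex) set" where
  "zygmund_class \<beta> q \<alpha> = {g \<in> bergman_space q \<alpha>. \<exists>C. zygmund_bound \<beta> q \<alpha> g C}"

definition zygmund_norm :: "real \<Rightarrow> real \<Rightarrow> real \<Rightarrow> (complex \<Rightarrow> complex) \<Rightarrow> real" where
  "zygmund_norm \<beta> q \<alpha> g = Inf {C. zygmund_bound \<beta> q \<alpha> g C}"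

text \<open>
  Replacing \<open>k\<close> by \<open>c * k\<close> with \<open>c > 0\<close> leaves the extremal function and the extremal polynomials
  unchanged but multiplies the Zygmund norm by \<open>c\<close>.  Estimates of the approximation error by the
  Zygmund norm of \<open>k\<close> therefore presuppose that the functional has norm 1; for general
  nonzero \<open>k\<close> the quantity that enters is the Zygmund norm of the kernel of the normalised functional.
\<close>

definition normalized_zygmund_norm ::
    "real \<Rightarrow> real \<Rightarrow> real \<Rightarrow> real \<Rightarrow> (complex \<Rightarrow> complex) \<Rightarrow> real" where
  "normalized_zygmund_norm \<beta> p q \<alpha> k = zygmund_norm \<beta> q \<alpha> k / bergman_functional_norm p \<alpha> k"

definition A_const :: "real \<Rightarrow> real" where
  "A_const \<gamma> = 2 powr (1 + \<gamma>) / pi *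
     (LINT t:{0<..}|lborel. \<bar>cos t - cos (2 * t)\<bar> * t powr (\<gamma> - 2))"

primrec H_fun :: "nat \<Rightarrow> real \<Rightarrow> real" where
  "H_fun 0 t = (cos t - cos (2 * t)) / (2 * t\<^sup>2)"
| "H_fun (Suc k) t = (LINT x:{t<..}|lborel. H_fun k x)"

definition C_const :: "nat \<Rightarrow> real" where
  "C_const k = 4 / pi * (LINT t:{0<..}|lborel. \<bar>H_fun k t\<bar>)"

definition B_tilde_0 :: real where
  "B_tilde_0 = C_const 2 / pi + pi * C_const 0"

end

theory Submission
  imports Defs
begin

text \<open>
  Let \<open>M\<close> be the norm of the functional \<open>\<phi>\<close> with kernel \<open>k\<close>.  Averaging the rotations of \<open>F\<close> against
  a nonnegative trigonometric kernel of degree \<open>n\<close> gives a polynomial \<open>P\<close> of degree at most \<open>n\<close> and,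
  by convexity, of norm at most 1.  A rotation of \<open>F\<close> can be moved onto \<open>k\<close>, so the Zygmund condition
  says that \<open>Re \<phi>(F(e\<^sup>i\<^sup>s z)) + Re \<phi>(F(e\<^sup>-\<^sup>i\<^sup>s z))\<close> differs from \<open>2 M\<close> by at most
  \<open>\<parallel>k\<parallel> \<bar>s\<bar>\<^sup>\<beta>\<close>.  With the Fejer-Korovkin kernel, whose root mean square is at most
  \<open>\<pi>\<^sup>2 / (2 n)\<close>, this shows that \<open>Re \<phi>(P)\<close>, hence also \<open>Re \<phi>(F\<^sub>n)\<close>, is at least
  \<open>M - O(n\<^sup>-\<^sup>\<beta>)\<close> when \<open>\<beta> \<le> 2\<close>, without any regularity of \<open>F\<close>.  Uniform convexity of \<open>L\<^sup>p\<close> turns this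
  into a bound on \<open>\<parallel>F - F\<^sub>n\<parallel>\<close> of order \<open>n\<^sup>-\<^sup>\<beta>\<^sup>/\<^sup>2\<close> or \<open>n\<^sup>-\<^sup>\<beta>\<^sup>/\<^sup>p\<close>, and interpolating with the trivial bound 2 gives the
  stated rates with the stated constants.  For \<open>\<beta> > 2\<close> the Zygmund condition makes \<open>s \<mapsto> \<phi>(F(e\<^sup>i\<^sup>s z))\<close>
  affine, so that \<open>F\<^sub>n = F\<close> on the disc; for \<open>\<beta> \<le> 0\<close> the bound 2 suffices.
\<close>

text \<open>Smoothness is known for k only. Since Re phi(P) is linear in P, the rotations of F can
  be moved onto k, and no smoothness of F has to be derived. The averaging kernel must be
  nonnegative with mass 1, so that averaging does not increase norms, and must have second moment
  O(n^-2). The Fejer kernel has second moment of order 1/n only and would lose the rate for 1 <=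
  beta <= 2; this forces the better coefficients. The constants of the statement do not arise from
  this argument, whose own constant is pi^2/2. They are reached by the comparison (pi^2/2)^gamma <=
  4 sqrt 2 A_gamma, and the analogous one for \<open>B_tilde_0\<close> with gamma = 1. The factor 4
  sqrt 2 is exactly the room that fourth powers leave when p < 2. The comparison rests on a
  numerical lower bound, uniform in gamma, for the integral in A_gamma.\<close>

unbundle no fps_syntax

section \<open>Rotation invariance of the Bergman measure\<close>

text \<open>Boxes determine Lebesgue measure, and in coordinates boxes of complex numbers are boxes
  of \<open>real^2\<close>. The detour makes invariance under orthogonal maps of
  \<open>real^2\<close> usable for multiplication by \<open>cis s\<close>.\<close>

lemma lborel_complex_eq_distr:
  "(lborel :: complex measure) = distr (lborel :: (real^2) measure) borel (\<lambda>v. Complex (v $ 1) (v $ 2))"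
proof (rule lborel_eqI)
  have m: "(\<lambda>v::real^2. Complex (v $ 1) (v $ 2)) \<in> borel_measurable borel"
    by (intro borel_measurable_continuous_onI) (auto simp: Complex_eq intro!: continuous_intros)
  fix l u :: complex
  assume le: "\<And>b. b \<in> Basis \<Longrightarrow> l \<bullet> b \<le> u \<bullet> b"
  have le': "Re l \<le> Re u" "Im l \<le> Im u"
    using le[of 1] le[of \<i>] by (auto simp: Basis_complex_def)
  have "(\<lambda>v::real^2. Complex (v $ 1) (v $ 2)) -` box l u = box (vector [Re l, Im l]) (vector [Re u, Im u])"
    by (auto simp: box_def Basis_complex_def Basis_vec_def forall_2 inner_axis)
  moreover have "emeasure lborel (box (vector [Re l, Im l] :: real^2) (vector [Re u, Im u])) = (Re u - Re l) * (Im u - Im l)"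
  proof -
    have B: "(Basis :: (real^2) set) = {axis 1 1, axis 2 1}"
      by (auto simp: Basis_vec_def UNIV_2)
    have ne: "axis 1 1 \<noteq> (axis 2 1 :: real^2)"
      by (simp add: axis_eq_axis)
    show ?thesis
      using le' unfolding emeasure_lborel_box_eq B by (auto simp: inner_axis ne)
  qed
  ultimately show "emeasure (distr lborel borel (\<lambda>v::real^2. Complex (v $ 1) (v $ 2))) (box l u) = (\<Prod>b\<in>Basis. (u - l) \<bullet> b)"
    using m by (simp add: emeasure_distr Basis_complex_def)
qed simp

text \<open>The preimage of a box is its image under the inverse map, which is again orthogonal and
  preserves \<open>lebesgue\<close> measure. Boxes and their preimages are Borel, so this carries
  over to \<open>lborel\<close>.\<close>

lemma distr_lborel_orthogonal:
  fixes f :: "real^'n::{finite,wellorder} \<Rightarrow> real^'n::_"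
  assumes f: "orthogonal_transformation f"
  shows "distr lborel borel f = lborel"
proof (rule lborel_eqI[symmetric])
  have lin: "linear f" using f by (rule orthogonal_transformation_linear)
  have m: "f \<in> borel_measurable borel"
    by (intro borel_measurable_continuous_onI linear_continuous_on lin linear_conv_bounded_linear[THEN iffD1])
  fix l u :: "real^'n::{finite,wellorder}"
  assume le: "\<And>b. b \<in> Basis \<Longrightarrow> l \<bullet> b \<le> u \<bullet> b"
  have bij: "bij f" using f by (rule orthogonal_transformation_bij)
  have eq: "f -` box l u = inv f ` box l u"
    using bij by (simp add: bij_vimage_eq_inv_image)
  have "measure lebesgue (inv f ` box l u) = measure lebesgue (box l u)"
    "inv f ` box l u \<in> lmeasurable"
    by (rule measure_orthogonal_image measurable_orthogonal_image; 
       use orthogonal_transformation_inv[OF f] in simp)+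
  moreover have "f -` box l u \<in> sets lborel"
    using measurable_sets[OF m, of "box l u"] by simp
  then have "emeasure lborel (f -` box l u) = emeasure lebesgue (f -` box l u)"
    by simp
  moreover have "emeasure lborel (box l u) = emeasure lebesgue (box l u)"
    by simp
  moreover have "box l u \<in> lmeasurable" by simp
  ultimately have "emeasure lborel (f -` box l u) = emeasure lborel (box l u)"
    unfolding eq by (metis emeasure_eq_measure2)
  then show "emeasure (distr lborel borel f) (box l u) = (\<Prod>b\<in>Basis. (u - l) \<bullet> b)"
    using m le by (simp add: emeasure_distr)
qed simp

lemma distr_lborel_cis: "distr lborel borel (\<lambda>z. cis s * z) = (lborel :: complex measure)"
proof -
  let ?T = "\<lambda>v::real^2. Complex (v $ 1) (v $ 2)"
  let ?R = "\<lambda>v::real^2. (vector [cos s * v $ 1 - sin s * v $ 2, sin s * v $ 1 + cos s * v $ 2] :: real^2)"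
  have mT [measurable]: "?T \<in> borel_measurable borel"
    by (intro borel_measurable_continuous_onI) (auto simp: Complex_eq intro!: continuous_intros)
  have R: "orthogonal_transformation ?R"
    unfolding orthogonal_transformation_def
  proof safe
    show "linear ?R"
      by (rule linearI) (auto simp: vec_eq_iff forall_2 algebra_simps)
    fix v w
    \<comment> \<open>Stated for free variables so that the factor \<open>d * d + c * c\<close>,
      equal to 1 for sine and cosine, stays in one piece.\<close>
    have "(c * a - d * b) * (c * a' - d * b') + (d * a + c * b) * (d * a' + c * b')
      = (a * a' + b * b') * (d * d + c * c)" for a a' b b' c d :: real
      by (simp add: algebra_simps)
    then have "?R v \<bullet> ?R w = (v$1 * w$1 + v$2 * w$2) * (sin s * sin s + cos s * cos s)"
      unfolding inner_vec_def sum_2 vector_2 inner_real_def .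
    also have "sin s * sin s + cos s * cos s = 1"
      by (simp flip: power2_eq_square)
    finally show "?R v \<bullet> ?R w = v \<bullet> w"
      by (simp add: inner_vec_def sum_2)
  qed
  have mR [measurable]: "?R \<in> borel_measurable borel"
    by (intro borel_measurable_continuous_onI linear_continuous_on linear_conv_bounded_linear[THEN iffD1]
          orthogonal_transformation_linear R)
  have "distr lborel borel (\<lambda>z. cis s * z) = distr (distr lborel borel ?T) borel (\<lambda>z. cis s * z)"
    by (subst lborel_complex_eq_distr) simp
  also have "\<dots> = distr lborel borel ((\<lambda>z. cis s * z) \<circ> ?T)"
    by (rule distr_distr) auto
  also have "(\<lambda>z. cis s * z) \<circ> ?T = ?T \<circ> ?R"
    by (auto simp: complex_eq_iff)
  also have "distr lborel borel (?T \<circ> ?R) = distr (distr lborel borel ?R) borel ?T"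
    by (rule distr_distr[symmetric]) auto
  also have "\<dots> = lborel"
    using distr_lborel_orthogonal[OF R] lborel_complex_eq_distr by simp
  finally show ?thesis .
qed

lemma space_bergman_measure [simp]: "space (bergman_measure \<alpha>) = ball 0 1"
  by (simp add: bergman_measure_def space_restrict_space)

lemma sets_bergman_measure [measurable_cong]:
  "sets (bergman_measure \<alpha>) = sets (restrict_space borel (ball 0 1))"
  by (simp add: bergman_measure_def sets_restrict_space)

lemma measurable_cis_mult [measurable]:
  "(\<lambda>z. cis s * z) \<in> measurable (bergman_measure \<alpha>) (bergman_measure \<alpha>)"
  unfolding measurable_cong_sets[OF sets_bergman_measure sets_bergman_measure]
  by (intro measurable_restrict_space2 measurable_restrict_space1) (auto simp: space_restrict_space norm_mult)

text \<open>The disc and the weight depend on \<open>cmod z\<close> only, so the claim reduces to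
  rotation invariance of Lebesgue measure.\<close>

lemma distr_bergman_measure_cis:
  "distr (bergman_measure \<alpha>) (bergman_measure \<alpha>) (\<lambda>z. cis s * z) = bergman_measure \<alpha>"
proof (rule measure_eqI)
  fix A assume "A \<in> sets (distr (bergman_measure \<alpha>) (bergman_measure \<alpha>) (\<lambda>z. cis s * z))"
  then have A: "A \<in> sets (bergman_measure \<alpha>)" by simp
  then have AB: "A \<subseteq> ball 0 1" "A \<in> sets borel"
    by (auto simp: sets_bergman_measure sets_restrict_space)
  have w [measurable]: "(\<lambda>z. ennreal ((\<alpha> + 1) / pi * (1 - (cmod z)\<^sup>2) powr \<alpha>)) \<in> borel_measurable borel"
    by measurable
  define w where "w = (\<lambda>z. ennreal ((\<alpha> + 1) / pi * (1 - (cmod z)\<^sup>2) powr \<alpha>))"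
  have w [measurable]: "w \<in> borel_measurable borel" by (simp add: w_def)
  have em: "emeasure (bergman_measure \<alpha>) B = (\<integral>\<^sup>+z. w z * indicator B z \<partial>lborel)"
    if "B \<in> sets borel" "B \<subseteq> ball 0 1" for B
  proof -
    have [measurable]: "B \<in> sets (restrict_space lborel (ball 0 1))"
      using that by (auto simp: sets_restrict_space)
    have "emeasure (bergman_measure \<alpha>) B = (\<integral>\<^sup>+z. w z * indicator B z \<partial>restrict_space lborel (ball 0 1))"
      unfolding bergman_measure_def w_def[symmetric]
      by (subst emeasure_density) (auto intro: measurable_restrict_space1)
    also have "\<dots> = (\<integral>\<^sup>+z. w z * indicator B z \<partial>lborel)"
      using that by (subst nn_integral_restrict_space) (auto intro!: nn_integral_cong split: split_indicator)
    finally show ?thesis .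
  qed
  let ?r = "\<lambda>z. cis s * z"
  have pre: "?r -` A \<inter> ball 0 1 = ?r -` A"
    using AB by (auto simp: norm_mult)
  have "?r -` A \<in> sets borel"
    using measurable_sets[of ?r borel borel A] AB by simp
  then have "emeasure (distr (bergman_measure \<alpha>) (bergman_measure \<alpha>) ?r) A = (\<integral>\<^sup>+z. w z * indicator (?r -` A) z \<partial>lborel)"
    using A pre by (subst emeasure_distr) (auto intro!: em)
  also have "\<dots> = (\<integral>\<^sup>+z. w (?r z) * indicator A (?r z) \<partial>lborel)"
    by (auto intro!: nn_integral_cong simp: w_def norm_mult split: split_indicator)
  also have "\<dots> = (\<integral>\<^sup>+z. w z * indicator A z \<partial>distr lborel borel ?r)"
    using AB by (subst nn_integral_distr) auto
  also have "\<dots> = emeasure (bergman_measure \<alpha>) A"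
    using AB by (simp add: distr_lborel_cis em)
  finally show "emeasure (distr (bergman_measure \<alpha>) (bergman_measure \<alpha>) ?r) A = emeasure (bergman_measure \<alpha>) A" .
qed simp

lemma
  fixes h :: "complex \<Rightarrow> 'b::{banach, second_countable_topology}"
  assumes [measurable]: "h \<in> borel_measurable (bergman_measure \<alpha>)"
  shows integral_bergman_cis: "(LINT z|bergman_measure \<alpha>. h (cis s * z)) = (LINT z|bergman_measure \<alpha>. h z)"
    and integrable_bergman_cis: "integrable (bergman_measure \<alpha>) (\<lambda>z. h (cis s * z)) \<longleftrightarrow> integrable (bergman_measure \<alpha>) h"
proof -
  show "(LINT z|bergman_measure \<alpha>. h (cis s * z)) = (LINT z|bergman_measure \<alpha>. h z)"
    by (subst (2) distr_bergman_measure_cis[symmetric, of \<alpha> s], subst integral_distr) auto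
  show "integrable (bergman_measure \<alpha>) (\<lambda>z. h (cis s * z)) \<longleftrightarrow> integrable (bergman_measure \<alpha>) h"
    by (subst (2) distr_bergman_measure_cis[symmetric, of \<alpha> s], subst integrable_distr_eq) auto
qed

lemma holomorphic_measurable_bergman:
  "f holomorphic_on ball 0 1 \<Longrightarrow> f \<in> borel_measurable (bergman_measure \<alpha>)"
  unfolding measurable_cong_sets[OF sets_bergman_measure refl]
  by (intro borel_measurable_continuous_on_restrict holomorphic_on_imp_continuous_on)

section \<open>Uniform convexity of Lebesgue spaces\<close>

text \<open>Tangent line of the convex function \<open>x powr p\<close> at 1, obtained from Young's
  inequality for the factors \<open>x\<close> and 1. Later it passes from the norm of a midpoint to
  the p-th power of that norm.\<close>

lemma powr_bernoulli:
  fixes x p :: real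
  assumes "1 < p" "0 \<le> x"
  shows "1 + p * (x - 1) \<le> x powr p"
proof -
  have "x * 1 \<le> x powr p / p + 1 powr (p / (p - 1)) / (p / (p - 1))"
    using assms by (intro Youngs_inequality) (auto simp: field_simps)
  also have "\<dots> = (x powr p + (p - 1)) / p"
    using assms by (simp add: add_divide_distrib)
  finally have "x * p \<le> x powr p + (p - 1)"
    using assms by (simp add: pos_le_divide_eq)
  then show ?thesis by (simp add: algebra_simps)
qed

text \<open>The concave counterpart: weighted arithmetic-geometric mean of \<open>x\<close> and 1.
  It serves the moments of the averaging kernel and a constant depending on p.\<close>

lemma powr_bernoulli_le:
  fixes x \<theta> :: real
  assumes "0 \<le> \<theta>" "\<theta> \<le> 1" "0 \<le> x"
  shows "x powr \<theta> \<le> \<theta> * x + (1 - \<theta>)"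
proof (cases "x = 0")
  case False
  then show ?thesis
    using Youngs_inequality_0[of \<theta> "1 - \<theta>" x 1] assms by simp
qed (use assms in auto)

text \<open>With the mean \<open>c\<close> of \<open>x\<close> and \<open>y\<close> scaled to 1, the
  linear terms of the two tangent bounds cancel.\<close>

lemma powr_midpoint:
  fixes x y p :: real
  assumes p: "1 < p" and "0 \<le> x" "0 \<le> y"
  shows "((x + y) / 2) powr p \<le> (x powr p + y powr p) / 2"
proof (cases "x + y = 0")
  case True
  then show ?thesis using assms by (simp add: add_nonneg_eq_0_iff)
next
  case False
  define c where "c = (x + y) / 2"
  have c: "c > 0" using False assms by (simp add: c_def)
  have "x + y = 2 * c" by (simp add: c_def)
  then have "x / c + y / c = 2"
    using c unfolding add_divide_distrib[symmetric] by simp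
  then have "p * (x / c + y / c) = p * 2" by simp
  then have "2 = (1 + p * (x / c - 1)) + (1 + p * (y / c - 1))"
    by (simp add: algebra_simps)
  also have "\<dots> \<le> (x / c) powr p + (y / c) powr p"
    using assms c by (intro add_mono powr_bernoulli) auto
  also have "\<dots> = (x powr p + y powr p) / c powr p"
    using assms c by (simp add: powr_divide add_divide_distrib)
  finally have "2 * c powr p \<le> x powr p + y powr p"
    using c by (simp add: field_simps)
  then show ?thesis by (simp add: c_def)
qed

lemma sq_powr_half:
  fixes x p :: real
  assumes "0 \<le> x"
  shows "(x\<^sup>2) powr (p / 2) = x powr p"
  using powr_powr[of x 2 "p/2"] assms by simp

lemma norm_diff_powr_le:
  fixes a b :: "'a::real_normed_vector"
  assumes p: "1 < p"
  shows "norm (a - b) powr p \<le> 2 powr (p - 1) * (norm a powr p + norm b powr p)"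
proof -
  have "norm (a - b) powr p \<le> (2 * ((norm a + norm b) / 2)) powr p"
    using p norm_triangle_ineq4[of a b] by (intro powr_mono2) auto
  also have "\<dots> = 2 powr p * ((norm a + norm b) / 2) powr p"
    by (subst powr_mult) auto
  also have "\<dots> \<le> 2 powr p * ((norm a powr p + norm b powr p) / 2)"
    using p by (intro mult_left_mono powr_midpoint) auto
  also have "\<dots> = 2 powr (p - 1) * (norm a powr p + norm b powr p)"
    by (simp add: powr_diff)
  finally show ?thesis .
qed

lemma norm_add_powr_le:
  fixes a b :: "'a::real_normed_vector"
  assumes p: "1 < p"
  shows "norm (a + b) powr p \<le> 2 powr (p - 1) * (norm a powr p + norm b powr p)"
  using norm_diff_powr_le[OF p, of a "-b"] by simp

text \<open>Parallelogram law for the squared norms, then superadditivity and convexity of the power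
  p/2, both valid because p/2 > 1.\<close>

lemma clarkson_pointwise:
  fixes a b :: "'a::real_inner"
  assumes p: "2 < p"
  shows "norm ((1/2) *\<^sub>R (a + b)) powr p + norm ((1/2) *\<^sub>R (a - b)) powr p \<le> (norm a powr p + norm b powr p) / 2"
proof -
  define u v where "u = (norm ((1/2) *\<^sub>R (a + b)))\<^sup>2" and "v = (norm ((1/2) *\<^sub>R (a - b)))\<^sup>2"
  have uv: "0 \<le> u" "0 \<le> v" by (auto simp: u_def v_def)
  have sum: "u + v = ((norm a)\<^sup>2 + (norm b)\<^sup>2) / 2"
    unfolding u_def v_def power2_norm_eq_inner by (simp add: inner_simps inner_commute field_simps)
  have super: "u powr (p/2) + v powr (p/2) \<le> (u + v) powr (p/2)"
  proof -
    have *: "x powr (p/2) \<le> x * (u + v) powr (p/2 - 1)" if "0 \<le> x" "x \<le> u + v" for x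
    proof (cases "x = 0")
      case False
      have "x powr (p/2) = x powr (1 + (p/2 - 1))" by simp
      also have "\<dots> = x * x powr (p/2 - 1)" using that False by (subst powr_add) auto
      also have "\<dots> \<le> x * (u + v) powr (p/2 - 1)"
        using that p by (intro mult_left_mono powr_mono2) auto
      finally show ?thesis .
    qed simp
    have "u powr (p/2) + v powr (p/2) \<le> u * (u + v) powr (p/2 - 1) + v * (u + v) powr (p/2 - 1)"
      using uv by (intro add_mono *) auto
    also have "\<dots> = (u + v) powr 1 * (u + v) powr (p/2 - 1)"
      using uv by (simp add: algebra_simps)
    also have "\<dots> = (u + v) powr (p/2)"
      by (subst powr_add[symmetric]) simp
    finally show ?thesis .
  qed
  have "norm ((1/2) *\<^sub>R (a + b)) powr p + norm ((1/2) *\<^sub>R (a - b)) powr p = u powr (p/2) + v powr (p/2)"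
    unfolding u_def v_def by (simp only: sq_powr_half norm_ge_zero)
  also note super
  also have "(u + v) powr (p/2) \<le> (((norm a)\<^sup>2) powr (p/2) + ((norm b)\<^sup>2) powr (p/2)) / 2"
    unfolding sum using p by (intro powr_midpoint) auto
  also have "\<dots> = (norm a powr p + norm b powr p) / 2"
    by (simp only: sq_powr_half norm_ge_zero)
  finally show ?thesis .
qed

text \<open>The quadratic stands for the squared norm along a segment, and \<open>disc\<close> for
  Cauchy-Schwarz. The second derivative of its power p/2 is at least \<open>p * (p - 1) * D\<close>
  times its power p/2 - 1. As this exponent is negative, the upper bound \<open>M\<close> turns it
  into the constant \<open>\<kappa>\<close>. Subtracting \<open>\<kappa> * t\<^sup>2 / 2\<close>
  therefore leaves a convex function, whose midpoint inequality yields the gain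
  \<open>\<kappa> / 8\<close>.\<close>

lemma quadratic_powr_midpoint:
  fixes A B D M p :: real
  assumes p: "1 < p" "p < 2"
    and pos: "\<And>t. 0 < A + 2 * B * t + D * t\<^sup>2"
    and disc: "B\<^sup>2 \<le> A * D" and D: "0 \<le> D"
    and M: "\<And>t. t \<in> {0..1} \<Longrightarrow> A + 2 * B * t + D * t\<^sup>2 \<le> M"
  shows "(A + B + D / 4) powr (p / 2) + p * (p - 1) / 8 * (D * M powr (p / 2 - 1))
    \<le> (A powr (p / 2) + (A + 2 * B + D) powr (p / 2)) / 2"
proof -
  define Q where "Q = (\<lambda>t. A + 2 * B * t + D * t\<^sup>2)"
  define \<kappa> where "\<kappa> = p * (p - 1) * (D * M powr (p / 2 - 1))"
  define h where "h = (\<lambda>t. Q t powr (p / 2) - \<kappa> * t\<^sup>2 / 2)"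
  define h' where "h' = (\<lambda>t. p * (Q t powr (p / 2 - 1) * (B + D * t)) - \<kappa> * t)"
  define h'' where "h'' = (\<lambda>t. p * (Q t powr (p / 2 - 2) * ((p - 2) * (B + D * t)\<^sup>2 + D * Q t)) - \<kappa>)"
  have Qpos: "0 < Q t" for t using pos by (simp add: Q_def)
  have QD: "(Q has_real_derivative 2 * (B + D * t)) (at t)" for t
    unfolding Q_def by (auto intro!: derivative_eq_intros simp: algebra_simps)
  have pw: "((\<lambda>t. Q t powr r) has_real_derivative r * Q t powr (r - 1) * (2 * (B + D * t))) (at t)" for r t
    using DERIV_fun_powr[OF QD Qpos, of r t] by (simp add: mult_ac)
  have d1: "(h has_real_derivative h' t) (at t)" for t
    unfolding h_def h'_def by (rule derivative_eq_intros pw refl | simp)+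
  have split: "Q t powr (p / 2 - 1) = Q t powr (p / 2 - 2) * Q t" for t
    using powr_add[of "Q t" "p/2 - 2" 1] Qpos[of t] by simp
  have d2: "(h' has_real_derivative h'' t) (at t)" for t
    unfolding h'_def h''_def
    by (rule derivative_eq_intros pw refl)+ (simp add: split algebra_simps power2_eq_square)
  have "convex_on {0..1} h"
  proof (rule f''_ge0_imp_convex[OF convex_real_interval(5) d1 d2])
    fix t :: real assume t: "t \<in> {0..1}"
    \<comment> \<open>The discriminant is constant along the segment, so the negative term
      \<open>(p - 2) * (B + D * t)\<^sup>2\<close> costs at most
      \<open>(2 - p) * (D * Q t)\<close>.\<close>
    have "D * Q t - (B + D * t)\<^sup>2 = A * D - B\<^sup>2"
      by (simp add: Q_def power2_eq_square algebra_simps)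
    then have "(B + D * t)\<^sup>2 \<le> D * Q t" using disc by linarith
    then have "(p - 2) * (D * Q t) \<le> (p - 2) * (B + D * t)\<^sup>2"
      using p by (intro mult_left_mono_neg) auto
    then have "(p - 1) * (D * Q t) \<le> (p - 2) * (B + D * t)\<^sup>2 + D * Q t"
      by (simp add: algebra_simps)
    then have "p * (Q t powr (p / 2 - 2) * ((p - 1) * (D * Q t)))
        \<le> p * (Q t powr (p / 2 - 2) * ((p - 2) * (B + D * t)\<^sup>2 + D * Q t))"
      using p by (intro mult_left_mono) auto
    moreover have "p * (Q t powr (p / 2 - 2) * ((p - 1) * (D * Q t))) = p * (p - 1) * (D * Q t powr (p / 2 - 1))"
      by (simp add: split algebra_simps)
    moreover have "\<kappa> \<le> p * (p - 1) * (D * Q t powr (p / 2 - 1))"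
      unfolding \<kappa>_def using p D t Qpos[of t] M[OF t]
      by (intro mult_left_mono powr_mono2') (auto simp: Q_def)
    ultimately show "0 \<le> h'' t" by (simp add: h''_def)
  qed
  then have "h ((1 - 1/2) *\<^sub>R 0 + (1/2) *\<^sub>R 1) \<le> (1 - 1/2) * h 0 + (1/2) * h 1"
    by (rule convex_onD) auto
  then show ?thesis
    by (simp add: h_def Q_def \<kappa>_def field_simps power2_eq_square)
qed

text \<open>For p < 2 the lower bound for the second derivative of the p-th power of the norm decays
  as vectors grow, so the gain carries the weight \<open>m powr (p - 2)\<close>, where
  \<open>m\<close> bounds both vectors.\<close>

lemma norm_powr_midpoint_strict:
  fixes a b :: "'a::real_inner"
  assumes p: "1 < p" "p < 2" and m: "norm a \<le> m" "norm b \<le> m"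
  shows "norm ((1/2) *\<^sub>R (a + b)) powr p + p * (p - 1) / 8 * (m powr (p - 2) * (norm (a - b))\<^sup>2)
    \<le> (norm a powr p + norm b powr p) / 2"
proof (cases "m = 0")
  case True
  then show ?thesis using m by simp
next
  case False
  have m0: "0 < m" using False m norm_ge_zero[of a] by linarith
  define B where "B = a \<bullet> (b - a)"
  define D where "D = (norm (a - b))\<^sup>2"
  define A where "A = (norm a)\<^sup>2"
  have bD: "D = (b - a) \<bullet> (b - a)"
    unfolding D_def by (metis norm_minus_commute power2_norm_eq_inner)
  have quad: "A + 2 * B * t + D * t\<^sup>2 = (norm (a + t *\<^sub>R (b - a)))\<^sup>2" for t
    unfolding power2_norm_eq_inner A_def B_def bD
    by (simp add: inner_simps inner_commute algebra_simps power2_eq_square)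
  have half: "A + B + D / 4 = (norm ((1/2) *\<^sub>R (a + b)))\<^sup>2"
  proof -
    have "a + (1/2) *\<^sub>R (b - a) = (1/2) *\<^sub>R (a + b)"
      by (simp add: algebra_simps) (metis field_sum_of_halves scaleR_add_left scaleR_one)
    then show ?thesis using quad[of "1/2"] by (simp add: power2_eq_square)
  qed
  have one: "A + 2 * B + D = (norm b)\<^sup>2"
    using quad[of 1] by simp
  have le_m: "A + 2 * B * t + D * t\<^sup>2 \<le> m\<^sup>2" if t: "t \<in> {0..1}" for t
  proof -
    have "a + t *\<^sub>R (b - a) = (1 - t) *\<^sub>R a + t *\<^sub>R b" by (simp add: algebra_simps)
    also have "norm \<dots> \<le> (1 - t) * m + t * m"
      using t m by (intro norm_triangle_le add_mono) (auto intro!: mult_left_mono)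
    finally show ?thesis
      unfolding quad by (intro power_mono) (auto simp: algebra_simps)
  qed
  have cs: "B\<^sup>2 \<le> A * D"
    unfolding A_def B_def D_def using Cauchy_Schwarz_ineq[of a "b - a"]
    by (simp add: power2_norm_eq_inner norm_minus_commute[of a b])
  \<comment> \<open>The segment from \<open>a\<close> to \<open>b\<close> may pass through 0, where the \<open>p\<close>-th power of the norm is not
    twice differentiable; adding \<open>e\<close> to the squared norm avoids this.\<close>
  have eps: "(A + e + B + D / 4) powr (p / 2) + p * (p - 1) / 8 * (D * (m\<^sup>2 + e) powr (p / 2 - 1))
    \<le> ((A + e) powr (p / 2) + (A + e + 2 * B + D) powr (p / 2)) / 2" if e: "0 < e" for e
  proof (rule quadratic_powr_midpoint[OF p])
    show "0 < A + e + 2 * B * t + D * t\<^sup>2" for t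
    proof -
      have "0 \<le> A + 2 * B * t + D * t\<^sup>2" unfolding quad by simp
      then show ?thesis using e by linarith
    qed
    have "0 \<le> e * D" using e by (simp add: D_def)
    then show "B\<^sup>2 \<le> (A + e) * D" using cs by (simp add: algebra_simps)
    show "0 \<le> D" by (simp add: D_def)
    show "A + e + 2 * B * t + D * t\<^sup>2 \<le> m\<^sup>2 + e" if "t \<in> {0..1}" for t
      using le_m[OF that] by linarith
  qed
  have ev: "eventually (\<lambda>e::real. 0 < e) (at_right 0)"
    by (simp add: eventually_at_right_less)
  have nn: "0 \<le> A" "0 \<le> A + B + D/4" "0 \<le> A + 2 * B + D"
    unfolding half one by (simp_all add: A_def)
  \<comment> \<open>The bases may tend to 0. There the power is continuous because p/2 is positive
    and the bases are eventually nonnegative. The negative exponent only meets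
    \<open>m\<^sup>2 + e\<close>, whose limit is positive.\<close>
  have ev': "eventually (\<lambda>e::real. 0 \<le> A + e) (at_right 0)"
       "eventually (\<lambda>e::real. 0 \<le> A + e + B + D / 4) (at_right 0)"
       "eventually (\<lambda>e::real. 0 \<le> A + e + 2 * B + D) (at_right 0)"
    using ev nn by (auto elim!: eventually_mono)
  have L: "((\<lambda>e. (A + e + B + D / 4) powr (p / 2) + p * (p - 1) / 8 * (D * (m\<^sup>2 + e) powr (p / 2 - 1)))
      \<longlongrightarrow> (A + 0 + B + D / 4) powr (p / 2) + p * (p - 1) / 8 * (D * (m\<^sup>2 + 0) powr (p / 2 - 1))) (at_right 0)"
    by (intro tendsto_intros tendsto_powr') (use p m0 ev' in auto)
  have R: "((\<lambda>e. ((A + e) powr (p / 2) + (A + e + 2 * B + D) powr (p / 2)) / 2)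
      \<longlongrightarrow> ((A + 0) powr (p / 2) + (A + 0 + 2 * B + D) powr (p / 2)) / 2) (at_right 0)"
    by (intro tendsto_intros tendsto_powr') (use p m0 ev' in auto)
  have "(A + 0 + B + D / 4) powr (p / 2) + p * (p - 1) / 8 * (D * (m\<^sup>2 + 0) powr (p / 2 - 1))
     \<le> ((A + 0) powr (p / 2) + (A + 0 + 2 * B + D) powr (p / 2)) / 2"
    by (rule tendsto_le[OF _ R L]) (use ev eps in \<open>auto elim!: eventually_mono\<close>)
  moreover have "(m\<^sup>2) powr (p / 2 - 1) = m powr (p - 2)"
    using sq_powr_half[of m "p - 2"] m0 by (simp add: diff_divide_distrib)
  ultimately show ?thesis
    by (simp add: half one sq_powr_half) (simp add: A_def D_def sq_powr_half mult_ac)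
qed

text \<open>Young's inequality for \<open>f x / A\<close> and \<open>g x / B\<close>; if
  \<open>A\<close> or \<open>B\<close> is 0, the product vanishes almost everywhere.\<close>

lemma holder_nonneg:
  fixes f g :: "'a \<Rightarrow> real"
  assumes pq: "1 < p" "1 < q" "1 / p + 1 / q = 1"
    and f[measurable]: "f \<in> borel_measurable M" and g[measurable]: "g \<in> borel_measurable M"
    and nn: "\<And>x. 0 \<le> f x" "\<And>x. 0 \<le> g x"
    and fp: "integrable M (\<lambda>x. f x powr p)" and gq: "integrable M (\<lambda>x. g x powr q)"
  shows "integrable M (\<lambda>x. f x * g x)"
    and "(LINT x|M. f x * g x) \<le> (LINT x|M. f x powr p) powr (1 / p) * (LINT x|M. g x powr q) powr (1 / q)"
proof -
  have Y: "a * b \<le> a powr p / p + b powr q / q" if "0 \<le> a" "0 \<le> b" for a b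
    using that pq by (intro Youngs_inequality)
  show int: "integrable M (\<lambda>x. f x * g x)"
    by (rule Bochner_Integration.integrable_bound[where f="\<lambda>x. f x powr p / p + g x powr q / q"])
      (use fp gq Y nn in \<open>auto intro!: AE_I2 order_trans[OF Y] simp: abs_of_nonneg\<close>)
  define A B where "A = (LINT x|M. f x powr p) powr (1 / p)" and "B = (LINT x|M. g x powr q) powr (1 / q)"
  have A0: "0 \<le> A" and B0: "0 \<le> B" by (auto simp: A_def B_def)
  have Ap: "A powr p = (LINT x|M. f x powr p)" and Bq: "B powr q = (LINT x|M. g x powr q)"
    using pq by (auto simp: A_def B_def powr_powr integral_nonneg_AE)
  show "(LINT x|M. f x * g x) \<le> A * B"
  proof (cases "A = 0 \<or> B = 0")
    case True
    have "AE x in M. f x * g x = 0"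
    proof (cases "A = 0")
      case True
      then have "(LINT x|M. f x powr p) = 0" using Ap by simp
      then have "AE x in M. f x powr p = 0"
        by (subst (asm) integral_nonneg_eq_0_iff_AE) (use fp in auto)
      then show ?thesis by (auto elim!: eventually_mono)
    next
      case False
      then have "(LINT x|M. g x powr q) = 0" using True Bq by simp
      then have "AE x in M. g x powr q = 0"
        by (subst (asm) integral_nonneg_eq_0_iff_AE) (use gq in auto)
      then show ?thesis by (auto elim!: eventually_mono)
    qed
    then have "(LINT x|M. f x * g x) = (LINT x|M. 0)"
      by (intro integral_cong_AE) auto
    then show ?thesis using A0 B0 by simp
  next
    case False
    then have AB: "0 < A" "0 < B" using A0 B0 by auto
    have "(LINT x|M. f x * g x) / (A * B) = (LINT x|M. (f x / A) * (g x / B))"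
      by simp
    also have "\<dots> \<le> (LINT x|M. (f x powr p / A powr p) / p + (g x powr q / B powr q) / q)"
    proof (rule integral_mono)
      show "integrable M (\<lambda>x. f x / A * (g x / B))" using int by simp
      show "integrable M (\<lambda>x. f x powr p / A powr p / p + g x powr q / B powr q / q)"
        using fp gq by simp
      show "f x / A * (g x / B) \<le> f x powr p / A powr p / p + g x powr q / B powr q / q" for x
        using Y[of "f x / A" "g x / B"] nn AB by (simp add: powr_divide)
    qed
    also have "\<dots> = (A powr p / A powr p) / p + (B powr q / B powr q) / q"
      using fp gq by (simp add: Ap Bq)
    also have "\<dots> = 1" using AB pq by simp
    finally show ?thesis using AB by (simp add: field_simps)
  qed
qed

lemma integrable_add_powr:
  fixes f g :: "'a \<Rightarrow> complex"
  assumes p: "1 < p"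
    and [measurable]: "f \<in> borel_measurable M" "g \<in> borel_measurable M"
    and "integrable M (\<lambda>x. cmod (f x) powr p)" "integrable M (\<lambda>x. cmod (g x) powr p)"
  shows "integrable M (\<lambda>x. cmod (f x + g x) powr p)"
proof (rule Bochner_Integration.integrable_bound)
  show "integrable M (\<lambda>x. 2 powr (p - 1) * (cmod (f x) powr p + cmod (g x) powr p))"
    using assms by simp
  show "AE x in M. norm (cmod (f x + g x) powr p) \<le> norm (2 powr (p - 1) * (cmod (f x) powr p + cmod (g x) powr p))"
    using norm_add_powr_le[OF p] by (intro AE_I2) simp
qed simp

lemma integrable_cmult_powr:
  fixes f :: "'a \<Rightarrow> complex"
  assumes "integrable M (\<lambda>x. cmod (f x) powr p)"
  shows "integrable M (\<lambda>x. cmod (c * f x) powr p)"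
  using assms by (simp add: norm_mult powr_mult)

lemma clarkson_Lp:
  fixes f g :: "'a \<Rightarrow> complex"
  assumes p: "2 < p"
    and [measurable]: "f \<in> borel_measurable M" "g \<in> borel_measurable M"
    and f: "integrable M (\<lambda>x. cmod (f x) powr p)" and g: "integrable M (\<lambda>x. cmod (g x) powr p)"
  shows "(LINT x|M. cmod ((f x + g x) / 2) powr p) + (LINT x|M. cmod ((f x - g x) / 2) powr p)
    \<le> ((LINT x|M. cmod (f x) powr p) + (LINT x|M. cmod (g x) powr p)) / 2"
proof -
  have p1: "1 < p" using p by simp
  have g': "integrable M (\<lambda>x. cmod (- g x) powr p)" using g by simp
  have s: "integrable M (\<lambda>x. cmod ((f x + g x) / 2) powr p)"
    using integrable_cmult_powr[OF integrable_add_powr[OF p1 _ _ f g], of "1/2"] by simp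
  have d: "integrable M (\<lambda>x. cmod ((f x - g x) / 2) powr p)"
    using integrable_cmult_powr[OF integrable_add_powr[OF p1 _ _ f g'], of "1/2"] by simp
  have "(LINT x|M. cmod ((f x + g x) / 2) powr p) + (LINT x|M. cmod ((f x - g x) / 2) powr p)
    = (LINT x|M. cmod ((f x + g x) / 2) powr p + cmod ((f x - g x) / 2) powr p)"
    using s d by simp
  also have "\<dots> \<le> (LINT x|M. (cmod (f x) powr p + cmod (g x) powr p) / 2)"
    using clarkson_pointwise[OF p, of "f x" "g x" for x] s d f g
    by (intro integral_mono) (auto simp: scaleR_conv_of_real)
  finally show ?thesis using f g by simp
qed

text \<open>Integrating the pointwise gain bounds \<open>X\<close>, the integral of
  \<open>m powr (p - 2)\<close> times the squared distance. Hoelder's inequality with exponents 2/p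
  and 2/(2 - p) removes the weight. The p-th power of the maximum \<open>m\<close> is at most the
  sum of the two p-th powers and so has integral at most 2, whence the factor
  \<open>2 powr (2 / p - 1)\<close>.\<close>

lemma uniform_convexity_Lp:
  fixes f g :: "'a \<Rightarrow> complex"
  assumes p: "1 < p" "p < 2"
    and [measurable]: "f \<in> borel_measurable M" "g \<in> borel_measurable M"
    and f: "integrable M (\<lambda>x. cmod (f x) powr p)" and g: "integrable M (\<lambda>x. cmod (g x) powr p)"
    and f1: "(LINT x|M. cmod (f x) powr p) = 1" and g1: "(LINT x|M. cmod (g x) powr p) = 1"
  shows "p * (p - 1) * (LINT x|M. cmod (f x - g x) powr p) powr (2 / p)
    \<le> 8 * 2 powr (2 / p - 1) * (1 - (LINT x|M. cmod ((f x + g x) / 2) powr p))"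
proof -
  define m where "m x = max (cmod (f x)) (cmod (g x))" for x
  define u where "u x = m x powr (p - 2) * (cmod (f x - g x))\<^sup>2" for x
  define X where "X = (LINT x|M. u x)"
  have [measurable]: "m \<in> borel_measurable M" "u \<in> borel_measurable M"
    unfolding m_def[abs_def] u_def[abs_def] by measurable
  have m0: "0 \<le> m x" for x by (simp add: m_def max_def)
  have u0: "0 \<le> u x" for x by (simp add: u_def)
  have g': "integrable M (\<lambda>x. cmod (- g x) powr p)" using g by simp
  have s: "integrable M (\<lambda>x. cmod ((f x + g x) / 2) powr p)"
    using integrable_cmult_powr[OF integrable_add_powr[OF p(1) _ _ f g], of "1/2"] by simp
  have pt: "cmod ((f x + g x) / 2) powr p + p * (p - 1) / 8 * u x \<le> (cmod (f x) powr p + cmod (g x) powr p) / 2" for x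
    using norm_powr_midpoint_strict[OF p, of "f x" "m x" "g x"] 
    by (simp add: u_def m_def scaleR_conv_of_real mult_ac)
  have c0: "0 < p * (p - 1)" using p by simp
  have uint: "integrable M u"
  proof (rule Bochner_Integration.integrable_bound)
    show "integrable M (\<lambda>x. 8 / (p * (p - 1)) * ((cmod (f x) powr p + cmod (g x) powr p) / 2))"
      using f g by simp
    have "u x \<le> 8 / (p * (p - 1)) * ((cmod (f x) powr p + cmod (g x) powr p) / 2)" for x
    proof -
      have "p * (p - 1) / 8 * u x \<le> (cmod (f x) powr p + cmod (g x) powr p) / 2"
        using pt[of x] by (smt (verit) powr_ge_zero)
      then show ?thesis using c0 by (simp add: field_simps)
    qed
    then show "AE x in M. norm (u x) \<le> norm (8 / (p * (p - 1)) * ((cmod (f x) powr p + cmod (g x) powr p) / 2))"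
      unfolding real_norm_def using u0 by (intro AE_I2) (metis abs_ge_self abs_of_nonneg order_trans)
  qed simp
  have "(LINT x|M. cmod ((f x + g x) / 2) powr p) + p * (p - 1) / 8 * X
      = (LINT x|M. cmod ((f x + g x) / 2) powr p + p * (p - 1) / 8 * u x)"
    using s uint by (simp add: X_def)
  also have "\<dots> \<le> (LINT x|M. (cmod (f x) powr p + cmod (g x) powr p) / 2)"
    using s uint f g pt by (intro integral_mono) auto
  also have "\<dots> = 1" using f g f1 g1 by simp
  finally have X: "p * (p - 1) * X \<le> 8 * (1 - (LINT x|M. cmod ((f x + g x) / 2) powr p))"
    by simp
  have mp: "integrable M (\<lambda>x. m x powr p)"
  proof (rule Bochner_Integration.integrable_bound)
    show "integrable M (\<lambda>x. cmod (f x) powr p + cmod (g x) powr p)" using f g by simp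
  qed (auto simp: m_def max_def)
  have mp2: "(LINT x|M. m x powr p) \<le> 2"
  proof -
    have "(LINT x|M. m x powr p) \<le> (LINT x|M. cmod (f x) powr p + cmod (g x) powr p)"
      using mp f g by (intro integral_mono) (auto simp: m_def max_def)
    then show ?thesis using f g f1 g1 by simp
  qed
  have split: "cmod (f x - g x) powr p = u x powr (p / 2) * (m x powr p) powr ((2 - p) / 2)" for x
  proof (cases "m x = 0")
    case True
    then have "cmod (f x) \<le> 0" "cmod (g x) \<le> 0" unfolding m_def by linarith+
    then have "f x = 0" "g x = 0" by simp_all
    then show ?thesis using p True by simp
  next
    case False
    have "u x powr (p / 2) = m x powr ((p - 2) * (p / 2)) * cmod (f x - g x) powr p"
      unfolding u_def by (simp add: powr_mult powr_powr sq_powr_half)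
    moreover have "(m x powr p) powr ((2 - p) / 2) = m x powr (- ((p - 2) * (p / 2)))"
      by (simp add: powr_powr algebra_simps diff_divide_distrib)
    ultimately show ?thesis using False m0[of x] by (simp add: powr_minus)
  qed
  have e1: "(u x powr (p/2)) powr (2/p) = u x" "((m x powr p) powr ((2 - p) / 2)) powr (2 / (2 - p)) = m x powr p" for x
    using p u0[of x] by (simp_all add: powr_powr)
  have "(LINT x|M. cmod (f x - g x) powr p) \<le> 
      (LINT x|M. (u x powr (p/2)) powr (2/p)) powr (1 / (2/p)) *
      (LINT x|M. ((m x powr p) powr ((2 - p) / 2)) powr (2 / (2 - p))) powr (1 / (2 / (2 - p)))"
    unfolding split using p uint mp
    by (intro holder_nonneg(2)) (auto simp: e1 field_simps)
  also have "\<dots> = X powr (p / 2) * (LINT x|M. m x powr p) powr ((2 - p) / 2)"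
    unfolding e1 X_def by simp
  also have "\<dots> \<le> X powr (p / 2) * 2 powr ((2 - p) / 2)"
    using p mp2 by (intro mult_left_mono powr_mono2) (auto intro!: integral_nonneg_AE)
  finally have "(LINT x|M. cmod (f x - g x) powr p) powr (2 / p) \<le> (X powr (p / 2) * 2 powr ((2 - p) / 2)) powr (2 / p)"
    using p by (intro powr_mono2) (auto intro!: integral_nonneg_AE)
  also have "\<dots> = X * 2 powr (2 / p - 1)"
  proof -
    have "0 \<le> X" unfolding X_def using u0 by (intro integral_nonneg_AE) auto
    moreover have "(2 - p) / 2 * (2 / p) = 2 / p - 1" using p by (simp add: field_simps)
    ultimately show ?thesis using p by (simp add: powr_mult powr_powr)
  qed
  finally have "p * (p - 1) * (LINT x|M. cmod (f x - g x) powr p) powr (2 / p) \<le> p * (p - 1) * (X * 2 powr (2 / p - 1))"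
    using c0 by (intro mult_left_mono) auto
  also have "\<dots> = (p * (p - 1) * X) * 2 powr (2 / p - 1)" by simp
  also have "\<dots> \<le> 8 * (1 - (LINT x|M. cmod ((f x + g x) / 2) powr p)) * 2 powr (2 / p - 1)"
    using X by (intro mult_right_mono) auto
  finally show ?thesis by (simp add: algebra_simps)
qed

text \<open>Stands in for the triangle inequality: on unit vectors, convexity of the p-th power
  already gives the sharp \<open>2 powr p\<close>.\<close>

lemma LINT_diff_powr_le:
  fixes f g :: "'a \<Rightarrow> complex"
  assumes p: "1 < p"
    and [measurable]: "f \<in> borel_measurable M" "g \<in> borel_measurable M"
    and f: "integrable M (\<lambda>x. cmod (f x) powr p)" and g: "integrable M (\<lambda>x. cmod (g x) powr p)"
    and f1: "(LINT x|M. cmod (f x) powr p) = 1" and g1: "(LINT x|M. cmod (g x) powr p) = 1"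
  shows "(LINT x|M. cmod (f x - g x) powr p) \<le> 2 powr p"
proof -
  have g': "integrable M (\<lambda>x. cmod (- g x) powr p)" using g by simp
  have "(LINT x|M. cmod (f x - g x) powr p) \<le> (LINT x|M. 2 powr (p - 1) * (cmod (f x) powr p + cmod (g x) powr p))"
    using integrable_add_powr[OF p _ _ f g'] f g p
    by (intro integral_mono norm_diff_powr_le) auto
  also have "\<dots> = 2 powr (p - 1) * 2 powr 1" using f g f1 g1 by simp
  also have "\<dots> = 2 powr p" by (subst powr_add[symmetric]) simp
  finally show ?thesis .
qed

section \<open>Duality and averages over rotations\<close>

lemma borel_measurable_cnj [measurable (raw)]:
  "f \<in> borel_measurable M \<Longrightarrow> (\<lambda>x. cnj (f x)) \<in> borel_measurable M"
  by (rule measurable_compose[of f M borel cnj borel])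
    (auto intro!: borel_measurable_continuous_onI continuous_intros)

text \<open>The assumptions are symmetric in \<open>p\<close> and \<open>q\<close>, so the locale
  can be reinterpreted with the exponents exchanged. Finiteness of the measure gives Fubini and puts
  bounded holomorphic functions into the spaces.\<close>

locale bergman_duality =
  fixes p q \<alpha> :: real
  assumes p_gt_1: "1 < p" and q_gt_1: "1 < q" and conj_exp: "1 / p + 1 / q = 1"
    and finite_bergman: "finite_measure (bergman_measure \<alpha>)"
begin

abbreviation \<mu> where "\<mu> \<equiv> bergman_measure \<alpha>"

sublocale finite_measure \<mu> by (rule finite_bergman)

lemma bergman_spaceD:
  assumes "f \<in> bergman_space r \<alpha>"
  shows "f holomorphic_on ball 0 1" "integrable \<mu> (\<lambda>z. cmod (f z) powr r)" "f \<in> borel_measurable \<mu>"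
  using assms holomorphic_measurable_bergman by (auto simp: bergman_space_def)

lemma bergman_space_add:
  assumes "1 < r" "f \<in> bergman_space r \<alpha>" "g \<in> bergman_space r \<alpha>"
  shows "(\<lambda>z. f z + g z) \<in> bergman_space r \<alpha>"
  using integrable_add_powr[OF assms(1) bergman_spaceD(3)[OF assms(2)] bergman_spaceD(3)[OF assms(3)]
      bergman_spaceD(2)[OF assms(2)] bergman_spaceD(2)[OF assms(3)]]
    holomorphic_on_add[OF bergman_spaceD(1)[OF assms(2)] bergman_spaceD(1)[OF assms(3)]]
  by (simp add: bergman_space_def)

lemma bergman_space_cmult:
  assumes "f \<in> bergman_space r \<alpha>"
  shows "(\<lambda>z. c * f z) \<in> bergman_space r \<alpha>"
  using integrable_cmult_powr[OF bergman_spaceD(2)[OF assms], of c]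
    holomorphic_on_mult[OF holomorphic_on_const bergman_spaceD(1)[OF assms], of c]
  by (simp only: bergman_space_def mem_Collect_eq simp_thms)

lemma bergman_space_diff:
  assumes "1 < r" "f \<in> bergman_space r \<alpha>" "g \<in> bergman_space r \<alpha>"
  shows "(\<lambda>z. f z - g z) \<in> bergman_space r \<alpha>"
  using bergman_space_add[OF assms(1,2) bergman_space_cmult[OF assms(3), of "-1"]] by simp

lemma bergman_space_rotate:
  assumes f: "f \<in> bergman_space r \<alpha>"
  shows "(\<lambda>z. f (cis s * z)) \<in> bergman_space r \<alpha>"
proof -
  note [measurable] = bergman_spaceD(3)[OF f]
  have "(f \<circ> (\<lambda>z. cis s * z)) holomorphic_on ball 0 1"
    by (rule holomorphic_on_compose_gen[OF _ bergman_spaceD(1)[OF f]])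
      (auto intro!: holomorphic_intros simp: norm_mult)
  moreover have "integrable \<mu> (\<lambda>z. cmod (f (cis s * z)) powr r)"
    using integrable_bergman_cis[of "\<lambda>z. cmod (f z) powr r" \<alpha> s] bergman_spaceD(2)[OF f] by simp
  ultimately show ?thesis by (simp add: bergman_space_def o_def)
qed

lemma LINT_powr_rotate:
  assumes f: "f \<in> borel_measurable \<mu>"
  shows "(LINT z|\<mu>. cmod (f (cis s * z)) powr r) = (LINT z|\<mu>. cmod (f z) powr r)"
proof -
  note [measurable] = f
  show ?thesis using integral_bergman_cis[of "\<lambda>z. cmod (f z) powr r" \<alpha> s] by simp
qed

lemma bergman_norm_nonneg: "0 \<le> bergman_norm r \<alpha> f"
  by (simp add: bergman_norm_def)

lemma bergman_norm_powr: "0 < r \<Longrightarrow> bergman_norm r \<alpha> f powr r = (LINT z|\<mu>. cmod (f z) powr r)"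
  by (simp add: bergman_norm_def powr_powr integral_nonneg_AE)

lemma bergman_norm_cmult: "0 < r \<Longrightarrow> bergman_norm r \<alpha> (\<lambda>z. c * f z) = cmod c * bergman_norm r \<alpha> f"
  by (simp add: bergman_norm_def norm_mult powr_mult powr_powr)

lemma bergman_norm_rotate:
  "f \<in> borel_measurable \<mu> \<Longrightarrow> bergman_norm r \<alpha> (\<lambda>z. f (cis s * z)) = bergman_norm r \<alpha> f"
  by (simp only: bergman_norm_def LINT_powr_rotate[of f s r])

lemma
  assumes f: "f \<in> bergman_space p \<alpha>" and k: "k \<in> bergman_space q \<alpha>"
  shows LINT_norm_pairing_le: "(LINT z|\<mu>. cmod (f z) * cmod (k z)) \<le> bergman_norm p \<alpha> f * bergman_norm q \<alpha> k"
    and integrable_pairing: "integrable \<mu> (\<lambda>z. f z * cnj (k z))"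
    and norm_functional_le: "cmod (bergman_functional \<alpha> k f) \<le> bergman_norm p \<alpha> f * bergman_norm q \<alpha> k"
proof -
  note [measurable] = bergman_spaceD(3)[OF f] bergman_spaceD(3)[OF k]
  have i: "integrable \<mu> (\<lambda>z. cmod (f z) * cmod (k z))"
    by (rule holder_nonneg[OF p_gt_1 q_gt_1 conj_exp]) (use f k bergman_spaceD in auto)
  show le: "(LINT z|\<mu>. cmod (f z) * cmod (k z)) \<le> bergman_norm p \<alpha> f * bergman_norm q \<alpha> k"
    unfolding bergman_norm_def
    by (rule holder_nonneg[OF p_gt_1 q_gt_1 conj_exp]) (use f k bergman_spaceD in auto)
  show i2: "integrable \<mu> (\<lambda>z. f z * cnj (k z))"
    by (rule Bochner_Integration.integrable_bound[OF i]) (auto simp: norm_mult)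
  have "cmod (bergman_functional \<alpha> k f) \<le> (LINT z|\<mu>. cmod (f z * cnj (k z)))"
    unfolding bergman_functional_def by (rule integral_norm_bound)
  also have "\<dots> = (LINT z|\<mu>. cmod (f z) * cmod (k z))" by (simp add: norm_mult)
  finally show "cmod (bergman_functional \<alpha> k f) \<le> bergman_norm p \<alpha> f * bergman_norm q \<alpha> k"
    using le by linarith
qed

lemma bergman_functional_add:
  assumes "f \<in> bergman_space p \<alpha>" "g \<in> bergman_space p \<alpha>" "k \<in> bergman_space q \<alpha>"
  shows "bergman_functional \<alpha> k (\<lambda>z. f z + g z) = bergman_functional \<alpha> k f + bergman_functional \<alpha> k g"
  using integrable_pairing assms by (simp add: bergman_functional_def ring_distribs)

lemma bergman_functional_cmult: "bergman_functional \<alpha> k (\<lambda>z. c * f z) = c * bergman_functional \<alpha> k f"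
  by (simp add: bergman_functional_def mult.assoc)

text \<open>Rotation invariance of the integral, applied to \<open>f\<close> times the conjugate of
  the rotated \<open>k\<close>. This transfers rotations from F to k, the function whose smoothness
  is known.\<close>

lemma bergman_functional_rotate:
  assumes f: "f \<in> borel_measurable \<mu>" and k: "k \<in> borel_measurable \<mu>"
  shows "bergman_functional \<alpha> k (\<lambda>z. f (cis s * z)) = bergman_functional \<alpha> (\<lambda>z. k (cis (- s) * z)) f"
proof -
  note [measurable] = f k
  have "bergman_functional \<alpha> (\<lambda>z. k (cis (- s) * z)) f
      = (LINT z|\<mu>. f (cis s * z) * cnj (k (cis (- s) * (cis s * z))))"
    unfolding bergman_functional_def
    by (rule integral_bergman_cis[symmetric, where h="\<lambda>z. f z * cnj (k (cis (- s) * z))"]) measurable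
  moreover have "cis (- s) * (cis s * z) = z" for z
    by (simp add: cis_mult flip: mult.assoc)
  ultimately show ?thesis by (simp add: bergman_functional_def)
qed

text \<open>The left side is the pairing of \<open>f\<close> with the symmetric second difference of
  \<open>k\<close>; the change of sign of \<open>s\<close> in the transfer is harmless because that
  difference is even in \<open>s\<close>. Hoelder's inequality and the Zygmund bound finish.\<close>

lemma functional_second_difference:
  assumes f: "f \<in> bergman_space p \<alpha>" and k: "k \<in> bergman_space q \<alpha>" and z: "zygmund_bound \<beta> q \<alpha> k C"
  shows "cmod (bergman_functional \<alpha> k (\<lambda>z. f (cis s * z)) + bergman_functional \<alpha> k (\<lambda>z. f (cis (- s) * z))
           - 2 * bergman_functional \<alpha> k f) \<le> bergman_norm p \<alpha> f * (C * \<bar>s\<bar> powr \<beta>)"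
proof -
  note fm = bergman_spaceD(3)[OF f] and km = bergman_spaceD(3)[OF k]
  define d where "d = (\<lambda>z. k (cis s * z) + k (cis (- s) * z) - 2 * k z)"
  have kr: "(\<lambda>z. k (cis t * z)) \<in> bergman_space q \<alpha>" for t by (rule bergman_space_rotate[OF k])
  have d: "d \<in> bergman_space q \<alpha>"
    unfolding d_def by (intro bergman_space_diff bergman_space_add kr bergman_space_cmult k q_gt_1)
  have "bergman_functional \<alpha> k (\<lambda>z. f (cis s * z)) + bergman_functional \<alpha> k (\<lambda>z. f (cis (- s) * z))
           - 2 * bergman_functional \<alpha> k f = bergman_functional \<alpha> d f"
  proof -
    have "bergman_functional \<alpha> d f = (LINT z|\<mu>. f z * cnj (k (cis s * z)) + f z * cnj (k (cis (- s) * z)) - 2 * (f z * cnj (k z)))"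
      unfolding bergman_functional_def d_def by (simp add: algebra_simps)
    also have "\<dots> = (LINT z|\<mu>. f z * cnj (k (cis s * z))) + (LINT z|\<mu>. f z * cnj (k (cis (- s) * z))) - 2 * (LINT z|\<mu>. f z * cnj (k z))"
      using integrable_pairing[OF f kr] integrable_pairing[OF f k] by simp
    finally show ?thesis
      using bergman_functional_rotate[OF fm km, of s] bergman_functional_rotate[OF fm km, of "- s"]
      by (simp add: bergman_functional_def)
  qed
  also have "cmod \<dots> \<le> bergman_norm p \<alpha> f * bergman_norm q \<alpha> d"
    by (rule norm_functional_le[OF f d])
  also have "\<dots> \<le> bergman_norm p \<alpha> f * (C * \<bar>s\<bar> powr \<beta>)"
    using z unfolding zygmund_bound_def d_def by (intro mult_left_mono bergman_norm_nonneg) auto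
  finally show ?thesis .
qed

text \<open>Joint measurability for Fubini. Only the sets of \<open>N\<close> are prescribed, so
  that it applies to several measures on the line.\<close>

lemma measurable_rotation_pair:
  assumes N: "sets N = sets borel"
  shows "(\<lambda>(s, z). cis s * z) \<in> measurable (N \<Otimes>\<^sub>M \<mu>) \<mu>"
proof -
  have id: "(\<lambda>z. z) \<in> measurable \<mu> borel"
    unfolding measurable_cong_sets[OF sets_bergman_measure refl] by (intro measurable_restrict_space1) simp
  have fst: "fst \<in> measurable (N \<Otimes>\<^sub>M \<mu>) borel"
    using measurable_fst[of N \<mu>] measurable_cong_sets[OF refl N] by blast
  have snd: "snd \<in> measurable (N \<Otimes>\<^sub>M \<mu>) borel"
    by (rule measurable_compose[OF measurable_snd id])
  have cis: "cis \<in> borel_measurable borel"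
    by (intro borel_measurable_continuous_onI continuous_intros)
  have "(\<lambda>x. cis (fst x) * snd x) \<in> borel_measurable (N \<Otimes>\<^sub>M \<mu>)"
    by (intro borel_measurable_times measurable_compose[OF fst cis] snd)
  then show ?thesis
    unfolding measurable_cong_sets[OF refl sets_bergman_measure]
    by (intro measurable_restrict_space2) (auto simp: space_pair_measure norm_mult split_beta')
qed

text \<open>For fixed \<open>z\<close> the rotations run through a circle that is compact in the
  open disc, where \<open>f\<close> is bounded.\<close>

lemma integrable_rotation:
  fixes f :: "complex \<Rightarrow> complex"
  assumes "finite_measure N" and N: "sets N = sets borel"
    and f: "f holomorphic_on ball 0 1" and z: "z \<in> ball 0 1" and r: "0 \<le> r"
  shows "integrable N (\<lambda>s. cmod (f (cis s * z)) powr r)" "(\<lambda>s. f (cis s * z)) \<in> borel_measurable N"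
proof -
  interpret N: finite_measure N by fact
  have sub: "sphere 0 (cmod z) \<subseteq> ball 0 1" using z by auto
  have cont: "continuous_on (sphere 0 (cmod z)) f"
    using f sub by (meson continuous_on_subset holomorphic_on_imp_continuous_on)
  then have "compact (f ` sphere 0 (cmod z))"
    by (intro compact_continuous_image) auto
  then obtain B where B: "\<And>w. w \<in> sphere 0 (cmod z) \<Longrightarrow> cmod (f w) \<le> B"
    using compact_imp_bounded bounded_iff by (metis imageI)
  then have B': "cmod (f (cis s * z)) \<le> B" for s by (simp add: norm_mult)
  have "continuous_on UNIV (\<lambda>s. f (cis s * z))"
    by (rule continuous_on_compose2[OF cont]) (auto intro!: continuous_intros simp: norm_mult)
  then have "(\<lambda>s. f (cis s * z)) \<in> borel_measurable borel"
    by (rule borel_measurable_continuous_onI)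
  then show m [measurable]: "(\<lambda>s. f (cis s * z)) \<in> borel_measurable N"
    using measurable_cong_sets[OF N refl] by blast
  show "integrable N (\<lambda>s. cmod (f (cis s * z)) powr r)"
    by (rule N.integrable_const_bound[of _ "B powr r"]) (auto intro!: powr_mono2 B' r)
qed

text \<open>Fubini, with a dominating bound independent of \<open>s\<close> because rotations
  preserve the norm. The complex weight \<open>w\<close> covers both plain averages (weight 1) and
  the extraction of Fourier coefficients (weight \<open>cis (- j * s)\<close>).\<close>

lemma
  fixes w :: "real \<Rightarrow> complex"
  assumes "finite_measure N" and N: "sets N = sets borel"
    and w[measurable]: "w \<in> borel_measurable N" and wb: "\<And>s. cmod (w s) \<le> W"
    and f: "f \<in> bergman_space p \<alpha>" and k: "k \<in> bergman_space q \<alpha>"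
  shows functional_average: "bergman_functional \<alpha> k (\<lambda>z. LINT s|N. w s * f (cis s * z))
      = (LINT s|N. w s * bergman_functional \<alpha> k (\<lambda>z. f (cis s * z)))"
    and integrable_functional_average: "integrable N (\<lambda>s. w s * bergman_functional \<alpha> k (\<lambda>z. f (cis s * z)))"
proof -
  interpret N: finite_measure N by fact
  interpret NM: pair_sigma_finite N \<mu> ..
  note fm = bergman_spaceD(3)[OF f] and km [measurable] = bergman_spaceD(3)[OF k]
  have [measurable]: "(\<lambda>x. f (cis (fst x) * snd x)) \<in> borel_measurable (N \<Otimes>\<^sub>M \<mu>)"
    using measurable_compose[OF measurable_rotation_pair[OF N] fm] by (simp add: split_beta')
  have fr: "(\<lambda>z. f (cis t * z)) \<in> bergman_space p \<alpha>" for t by (rule bergman_space_rotate[OF f])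
  define G where "G = (\<lambda>s z. w s * (f (cis s * z) * cnj (k z)))"
  have Gm [measurable]: "case_prod G \<in> borel_measurable (N \<Otimes>\<^sub>M \<mu>)"
    unfolding G_def split_beta' by measurable
  have W: "0 \<le> W" using wb[of 0] norm_ge_zero order_trans by blast
  have bound: "(LINT z|\<mu>. norm (G s z)) \<le> W * (bergman_norm p \<alpha> f * bergman_norm q \<alpha> k)" for s
  proof -
    have "(LINT z|\<mu>. norm (G s z)) = cmod (w s) * (LINT z|\<mu>. cmod (f (cis s * z)) * cmod (k z))"
      by (simp add: G_def norm_mult)
    also have "\<dots> \<le> W * (bergman_norm p \<alpha> (\<lambda>z. f (cis s * z)) * bergman_norm q \<alpha> k)"
      by (intro mult_mono wb LINT_norm_pairing_le fr k W) (auto intro!: integral_nonneg_AE)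
    finally show ?thesis by (simp add: bergman_norm_rotate[OF fm])
  qed
  have GI: "integrable (N \<Otimes>\<^sub>M \<mu>) (case_prod G)"
  proof (rule NM.Fubini_integrable)
    have "(\<lambda>s. LINT z|\<mu>. norm (G s z)) \<in> borel_measurable N"
    proof (rule borel_measurable_lebesgue_integral)
      have "(\<lambda>x. cmod (case_prod G x)) \<in> borel_measurable (N \<Otimes>\<^sub>M \<mu>)" by measurable
      then show "(\<lambda>(s, z). cmod (G s z)) \<in> borel_measurable (N \<Otimes>\<^sub>M \<mu>)"
        by (simp add: split_beta')
    qed
    then show "integrable N (\<lambda>x. LINT y|\<mu>. norm (case (x, y) of (a, b) \<Rightarrow> G a b))"
      by (intro N.integrable_const_bound[of _ "W * (bergman_norm p \<alpha> f * bergman_norm q \<alpha> k)"])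
        (use bound in \<open>auto simp: abs_of_nonneg integral_nonneg_AE\<close>)
    show "AE x in N. integrable \<mu> (\<lambda>y. case (x, y) of (a, b) \<Rightarrow> G a b)"
      using integrable_pairing[OF fr k] by (auto simp: G_def)
  qed simp
  have inner: "(LINT z|\<mu>. G s z) = w s * bergman_functional \<alpha> k (\<lambda>z. f (cis s * z))" for s
    by (simp add: G_def bergman_functional_def)
  show "integrable N (\<lambda>s. w s * bergman_functional \<alpha> k (\<lambda>z. f (cis s * z)))"
    using NM.integrable_fst[OF GI] by (simp add: inner)
  have "bergman_functional \<alpha> k (\<lambda>z. LINT s|N. w s * f (cis s * z)) = (LINT z|\<mu>. (LINT s|N. G s z))"
    unfolding bergman_functional_def G_def by (simp flip: mult.assoc)
  also have "\<dots> = (LINT s|N. (LINT z|\<mu>. G s z))"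
    by (rule NM.Fubini_integral[OF GI])
  finally show "bergman_functional \<alpha> k (\<lambda>z. LINT s|N. w s * f (cis s * z))
      = (LINT s|N. w s * bergman_functional \<alpha> k (\<lambda>z. f (cis s * z)))"
    by (simp add: inner)
qed

text \<open>Jensen's inequality under the integral, obtained from Hoelder's inequality against the
  constant 1 on a space of mass 1; then Fubini, all rotations having the same norm.\<close>

lemma bergman_norm_average_le:
  assumes "finite_measure N" and N1: "measure N (space N) = 1" and N: "sets N = sets borel" and f: "f \<in> bergman_space p \<alpha>"
  shows "bergman_norm p \<alpha> (\<lambda>z. LINT s|N. f (cis s * z)) \<le> bergman_norm p \<alpha> f"
proof -
  interpret N: finite_measure N by fact
  interpret NM: pair_sigma_finite N \<mu> ..
  note fm = bergman_spaceD(3)[OF f]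
  have fm2 [measurable]: "(\<lambda>x. f (cis (fst x) * snd x)) \<in> borel_measurable (N \<Otimes>\<^sub>M \<mu>)"
    using measurable_compose[OF measurable_rotation_pair[OF N] fm] by (simp add: split_beta')
  have fr: "(\<lambda>z. f (cis t * z)) \<in> bergman_space p \<alpha>" for t by (rule bergman_space_rotate[OF f])
  define G where "G = (\<lambda>s z. cmod (f (cis s * z)) powr p)"
  have Gm [measurable]: "case_prod G \<in> borel_measurable (N \<Otimes>\<^sub>M \<mu>)"
    unfolding G_def split_beta' by measurable
  have inner: "(LINT z|\<mu>. G s z) = (LINT z|\<mu>. cmod (f z) powr p)" for s
    unfolding G_def by (rule LINT_powr_rotate[OF fm])
  have GI: "integrable (N \<Otimes>\<^sub>M \<mu>) (case_prod G)"
  proof (rule NM.Fubini_integrable)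
    show "integrable N (\<lambda>x. LINT y|\<mu>. norm (case (x, y) of (a, b) \<Rightarrow> G a b))"
      using inner by (simp add: G_def)
    show "AE x in N. integrable \<mu> (\<lambda>y. case (x, y) of (a, b) \<Rightarrow> G a b)"
      using bergman_spaceD(2)[OF fr] by (auto simp: G_def)
  qed simp
  define a where "a = (\<lambda>z. LINT s|N. f (cis s * z))"
  have am [measurable]: "a \<in> borel_measurable \<mu>"
    unfolding a_def
    by (rule N.borel_measurable_lebesgue_integral)
      (use measurable_compose[OF measurable_pair_swap' fm2] in \<open>simp add: split_beta'\<close>)
  have le: "cmod (a z) powr p \<le> (LINT s|N. G s z)" if z: "z \<in> ball 0 1" for z
  proof -
    have p0: "0 \<le> p" using p_gt_1 by simp
    note i = integrable_rotation[OF N.finite_measure_axioms N bergman_spaceD(1)[OF f] z p0]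
    note [measurable] = i(2)
    have "cmod (a z) \<le> (LINT s|N. cmod (f (cis s * z)) * 1)"
      unfolding a_def by (simp add: integral_norm_bound)
    also have "\<dots> \<le> (LINT s|N. cmod (f (cis s * z)) powr p) powr (1 / p) * (LINT s|N. 1 powr q) powr (1 / q)"
      by (rule holder_nonneg(2)[OF p_gt_1 q_gt_1 conj_exp]) (use i p_gt_1 in auto)
    also have "\<dots> = (LINT s|N. G s z) powr (1 / p)"
      by (simp add: G_def N1)
    finally have "cmod (a z) powr p \<le> ((LINT s|N. G s z) powr (1 / p)) powr p"
      using p_gt_1 by (intro powr_mono2) auto
    also have "\<dots> = (LINT s|N. G s z)"
      using p_gt_1 by (simp add: powr_powr G_def integral_nonneg_AE)
    finally show ?thesis .
  qed
  have Gi: "integrable \<mu> (\<lambda>z. LINT s|N. G s z)" by (rule NM.integrable_snd[OF GI])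
  have ai: "integrable \<mu> (\<lambda>z. cmod (a z) powr p)"
  proof (rule Bochner_Integration.integrable_bound[OF Gi])
    show "AE z in \<mu>. norm (cmod (a z) powr p) \<le> norm (LINT s|N. G s z)"
      using le by (intro AE_I2) (auto intro: order_trans[OF _ abs_ge_self])
  qed measurable
  have "(LINT z|\<mu>. cmod (a z) powr p) \<le> (LINT z|\<mu>. (LINT s|N. G s z))"
    by (rule integral_mono) (use ai Gi le in auto)
  also have "\<dots> = (LINT s|N. (LINT z|\<mu>. G s z))" by (rule NM.Fubini_integral[OF GI])
  also have "\<dots> = (LINT z|\<mu>. cmod (f z) powr p)" by (simp add: inner N1)
  finally show "bergman_norm p \<alpha> (\<lambda>z. LINT s|N. f (cis s * z)) \<le> bergman_norm p \<alpha> f"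
    unfolding bergman_norm_def a_def using p_gt_1 by (intro powr_mono2) (auto intro!: integral_nonneg_AE)
qed

end

section \<open>The Fejer-Korovkin kernel\<close>

text \<open>Normalised arc length, carried by the whole real line so that Borel measurability
  applies without restricting the space.\<close>

definition circle_measure :: "real measure" where
  "circle_measure = density lborel (\<lambda>s. ennreal (indicator {-pi..pi} s / (2 * pi)))"

lemma sets_circle_measure [simp, measurable_cong]: "sets circle_measure = sets borel"
  and space_circle_measure [simp]: "space circle_measure = UNIV"
  by (simp_all add: circle_measure_def)

lemma finite_circle_measure: "finite_measure circle_measure"
proof (rule finite_measureI)
  have "emeasure circle_measure (space circle_measure) = (\<integral>\<^sup>+s. ennreal (1 / (2 * pi)) * indicator {-pi..pi} s \<partial>lborel)"
    unfolding circle_measure_def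
    by (subst emeasure_density) (auto intro!: nn_integral_cong split: split_indicator)
  also have "\<dots> = ennreal (1 / (2 * pi)) * ennreal (2 * pi)"
    by (subst nn_integral_cmult_indicator) auto
  finally show "emeasure circle_measure (space circle_measure) \<noteq> \<infinity>"
    by (simp add: ennreal_mult_eq_top_iff)
qed

lemma integral_circle_measure:
  fixes f :: "real \<Rightarrow> 'b::{banach, second_countable_topology}"
  assumes "f \<in> borel_measurable borel"
  shows "(LINT s|circle_measure. f s) = (1 / (2 * pi)) *\<^sub>R (LINT s:{-pi..pi}|lborel. f s)"
  using assms unfolding circle_measure_def set_lebesgue_integral_def
  by (subst integral_density) (auto simp flip: integral_scaleR_right intro!: Bochner_Integration.integral_cong split: split_indicator)

lemma borel_measurable_cis [measurable (raw)]:
  "f \<in> borel_measurable M \<Longrightarrow> (\<lambda>x. cis (f x)) \<in> borel_measurable M"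
  by (rule measurable_compose[of f M borel cis borel])
    (auto intro!: borel_measurable_continuous_onI continuous_intros)

lemma integral_cis: "(LINT s|circle_measure. cis (of_int m * s)) = (if m = 0 then 1 else 0)"
proof (cases "m = 0")
  case True
  then show ?thesis
    by (subst integral_circle_measure) (auto simp: set_lebesgue_integral_def scaleR_conv_of_real)
next
  case False
  have "((\<lambda>s. cis (of_int m * s) / (\<i> * of_int m)) has_vector_derivative cis (of_int m * s)) (at s within A)" for s A
  proof -
    have "((\<lambda>s. exp (\<i> * of_int m * of_real s) / (\<i> * of_int m)) has_vector_derivative exp (\<i> * of_int m * of_real s)) (at s within A)"
      using False by (auto intro!: derivative_eq_intros has_vector_derivative_real_field simp: field_simps)
    then show ?thesis by (simp add: cis_conv_exp mult_ac)
  qed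
  then have "(LINT s:{-pi..pi}|lborel. cis (of_int m * s)) = cis (of_int m * pi) / (\<i> * of_int m) - cis (of_int m * (- pi)) / (\<i> * of_int m)"
    unfolding set_lebesgue_integral_def
    by (intro integral_FTC_Icc) (auto intro!: continuous_intros)
  also have "cis (of_int m * (- pi)) = cis (of_int m * pi)"
    by (simp add: complex_eq_iff sin_times_pi_eq_0 mult.commute)
  finally have "(LINT s:{-pi..pi}|lborel. cis (of_int m * s)) = 0" by simp
  then show ?thesis using False
    by (subst integral_circle_measure) auto
qed

text \<open>Termwise integration of the power series on the circle through \<open>z\<close>:
  orthogonality keeps only the term of degree \<open>- m\<close>, and there is none when
  \<open>m\<close> is positive.\<close>

lemma fourier_coefficient_holomorphic:
  assumes F: "F holomorphic_on ball 0 1" and z: "z \<in> ball 0 1"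
  shows "(LINT s|circle_measure. cis (of_int m * s) * F (cis s * z))
    = (if m \<le> 0 then (deriv ^^ nat (- m)) F 0 / fact (nat (- m)) * z ^ nat (- m) else 0)"
proof -
  interpret finite_measure circle_measure by (rule finite_circle_measure)
  define c where "c j = (deriv ^^ j) F 0 / fact j" for j
  define g where "g = (\<lambda>j s. cis (of_int m * s) * (c j * (cis s * z) ^ j))"
  have pow: "(\<lambda>j. c j * w ^ j) sums F w" if "w \<in> ball 0 1" for w
    using holomorphic_power_series[OF F that] by (simp add: c_def)
  \<comment> \<open>Convergence at a radius strictly beyond \<open>cmod z\<close> gives absolute
    convergence at \<open>z\<close>, as the exchange of sum and integral requires.\<close>
  obtain r where r: "cmod z < r" "r < 1" using z dense[of "cmod z" 1] by auto
  have "summable (\<lambda>j. c j * of_real r ^ j)"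
    using pow[of "of_real r"] r norm_ge_zero[of z] by (auto simp: sums_iff)
  then have "summable (\<lambda>j. norm (c j * z ^ j))"
    by (rule powser_insidea) (use r in auto)
  moreover have gn: "norm (g j s) = norm (c j * z ^ j)" for j s
    by (simp add: g_def norm_mult norm_power)
  ultimately have sm: "summable (\<lambda>j. norm (g j s))" "summable (\<lambda>j. LINT s|circle_measure. norm (g j s))" for s
    by (auto intro: summable_mult)
  have gi: "integrable circle_measure (g j)" for j
  proof (rule integrable_const_bound)
    show "g j \<in> borel_measurable circle_measure" unfolding g_def by measurable
    show "AE s in circle_measure. norm (g j s) \<le> norm (c j * z ^ j)" using gn by simp
  qed
  have gint: "(LINT s|circle_measure. g j s) = (if m + int j = 0 then c j * z ^ j else 0)" for j
  proof -
    have "g j s = c j * z ^ j * cis (of_int (m + int j) * s)" for s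
      using Complex.DeMoivre[of s j] by (simp add: g_def power_mult_distrib cis_mult[symmetric] algebra_simps)
    then have "(LINT s|circle_measure. g j s) = c j * z ^ j * (LINT s|circle_measure. cis (of_int (m + int j) * s))"
      by (simp only: integral_mult_right_zero)
    then show ?thesis by (simp only: integral_cis) simp
  qed
  have "(\<lambda>j. LINT s|circle_measure. g j s) sums (LINT s|circle_measure. (\<Sum>j. g j s))"
    by (rule sums_integral[OF gi]) (use sm in auto)
  moreover have "(\<Sum>j. g j s) = cis (of_int m * s) * F (cis s * z)" for s
    unfolding g_def using sums_mult[OF pow[of "cis s * z"]] z by (intro sums_unique[symmetric]) (auto simp: norm_mult)
  ultimately have S: "(\<lambda>j. if m + int j = 0 then c j * z ^ j else 0) sums (LINT s|circle_measure. cis (of_int m * s) * F (cis s * z))"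
    by (simp add: gint)
  show ?thesis
  proof (cases "m \<le> 0")
    case True
    then have "(\<lambda>j. if m + int j = 0 then c j * z ^ j else 0) = (\<lambda>j. if j = nat (- m) then c j * z ^ j else 0)"
      by (intro ext if_cong) auto
    then show ?thesis
      using S sums_unique2[OF _ sums_single[of "nat (- m)" "\<lambda>j. c j * z ^ j"]] True
      by (simp add: c_def)
  next
    case False
    then have "(\<lambda>j. if m + int j = 0 then c j * z ^ j else 0) = (\<lambda>j. 0)"
      by (intro ext) auto
    then have "(\<lambda>j. 0) sums (LINT s|circle_measure. cis (of_int m * s) * F (cis s * z))"
      using S by simp
    then show ?thesis using sums_unique2[OF _ sums_zero] False by auto
  qed
qed

text \<open>On \<open>{0..pi/2}\<close> the sine is concave and lies above its chord.\<close>

lemma jordan_sin: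
  assumes "0 \<le> x" "x \<le> pi / 2"
  shows "2 * x / pi \<le> sin x"
proof -
  have "convex_on {0..pi/2} (\<lambda>x. - sin x)"
    by (rule f''_ge0_imp_convex[where f'="\<lambda>x. - cos x" and f''="\<lambda>x. sin x"])
      (auto intro!: derivative_eq_intros sin_ge_zero)
  then have "- sin ((1 - 2 * x / pi) *\<^sub>R 0 + (2 * x / pi) *\<^sub>R (pi / 2))
      \<le> (1 - 2 * x / pi) * (- sin 0) + (2 * x / pi) * (- sin (pi / 2))"
    by (rule convex_onD) (use assms in \<open>auto simp: field_simps\<close>)
  then show ?thesis by simp
qed

text \<open>Half-angle formula and the chord bound for the sine. It replaces the second moment of
  the kernel by the cosine moment, which is known exactly.\<close>

lemma square_le_one_minus_cos:
  assumes "\<bar>s\<bar> \<le> pi"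
  shows "s\<^sup>2 \<le> pi\<^sup>2 / 2 * (1 - cos s)"
proof -
  have "(2 * (\<bar>s\<bar> / 2) / pi)\<^sup>2 \<le> (sin (\<bar>s\<bar> / 2))\<^sup>2"
    using assms by (intro power_mono jordan_sin) auto
  moreover have "cos s = 1 - 2 * (sin (\<bar>s\<bar> / 2))\<^sup>2"
    using cos_double_sin[of "\<bar>s\<bar> / 2"] by simp
  ultimately have "s\<^sup>2 / pi\<^sup>2 \<le> (sin (\<bar>s\<bar> / 2))\<^sup>2" "1 - cos s = 2 * (sin (\<bar>s\<bar> / 2))\<^sup>2"
    by (simp_all add: power_divide)
  then show ?thesis by (simp add: pos_divide_le_eq mult.commute)
qed

lemma one_minus_cos_le: "1 - cos x \<le> x\<^sup>2 / 2" for x :: real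
proof -
  have "(sin (x / 2))\<^sup>2 \<le> (x / 2)\<^sup>2"
    using abs_sin_x_le_abs_x[of "x/2"] by (simp only: abs_le_square_iff)
  then show ?thesis using cos_double_sin[of "x / 2"] by (simp add: power_divide)
qed

context
  fixes n :: nat
begin

text \<open>
  The coefficients form the top eigenvector of the adjacency matrix of a path with \<open>n + 1\<close> vertices,
  which maximises the integral of \<open>cos s\<close> against the normalised kernel.
\<close>

definition fk_coeff :: "nat \<Rightarrow> real" where
  "fk_coeff k = sin (real (k + 1) * pi / real (n + 2))"

definition fk_total :: real where
  "fk_total = (\<Sum>k\<le>n. (fk_coeff k)\<^sup>2)"

text \<open>As a squared modulus it is nonnegative with frequencies between -n and n; division by
  \<open>fk_total\<close> makes its constant Fourier coefficient 1.\<close>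

definition fk_kernel :: "real \<Rightarrow> real" where
  "fk_kernel s = (cmod (\<Sum>k\<le>n. of_real (fk_coeff k) * cis (real k * s)))\<^sup>2 / fk_total"

definition fk_measure :: "real measure" where
  "fk_measure = density circle_measure (\<lambda>s. ennreal (fk_kernel s))"

lemma fk_total_pos: "0 < fk_total"
proof -
  have "0 < fk_coeff k" if "k \<le> n" for k
    unfolding fk_coeff_def
  proof (rule sin_gt_zero)
    have "real (k + 1) * pi < real (n + 2) * pi" using that by (intro mult_strict_right_mono) auto
    then show "real (k + 1) * pi / real (n + 2) < pi" by (simp add: pos_divide_less_eq mult.commute)
  qed simp
  then show ?thesis unfolding fk_total_def by (intro sum_pos zero_less_power) auto
qed

lemma fk_kernel_nonneg: "0 \<le> fk_kernel s"
  using fk_total_pos by (simp add: fk_kernel_def)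

lemma measurable_fk_kernel [measurable]: "fk_kernel \<in> borel_measurable borel"
  unfolding fk_kernel_def[abs_def] by measurable

lemma fk_kernel_expand:
  "complex_of_real (fk_kernel s)
    = (\<Sum>k\<le>n. \<Sum>l\<le>n. of_real (fk_coeff k * fk_coeff l / fk_total) * cis (of_int (int k - int l) * s))"
proof -
  have "complex_of_real (fk_kernel s) =
    (\<Sum>k\<le>n. of_real (fk_coeff k) * cis (real k * s)) * cnj (\<Sum>k\<le>n. of_real (fk_coeff k) * cis (real k * s)) / of_real fk_total"
    unfolding fk_kernel_def of_real_divide complex_norm_square ..
  also have "\<dots> = (\<Sum>k\<le>n. \<Sum>l\<le>n. of_real (fk_coeff k) * cis (real k * s) * (of_real (fk_coeff l) * cis (- (real l * s)))) / of_real fk_total"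
    by (simp add: sum_product cis_cnj)
  also have "\<dots> = (\<Sum>k\<le>n. \<Sum>l\<le>n. of_real (fk_coeff k * fk_coeff l / fk_total) * cis (of_int (int k - int l) * s))"
  proof -
    have "cis (of_int (int k - int l) * s) = cis (real k * s) * cis (- (real l * s))" for k l
      by (simp add: cis_mult left_diff_distrib)
    then show ?thesis
      unfolding sum_divide_distrib by (intro sum.cong refl) simp
  qed
  finally show ?thesis .
qed

lemma sets_fk_measure [simp, measurable_cong]: "sets fk_measure = sets borel"
  and space_fk_measure [simp]: "space fk_measure = UNIV"
  by (simp_all add: fk_measure_def)

text \<open>Reduces integration against the kernel to finitely many Fourier coefficients of
  \<open>f\<close>; boundedness makes each of them meaningful.\<close>

lemma integral_fk_measure:
  fixes f :: "real \<Rightarrow> complex"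
  assumes f [measurable]: "f \<in> borel_measurable borel" and B: "\<And>s. cmod (f s) \<le> B"
  shows "(LINT s|fk_measure. f s) = (\<Sum>k\<le>n. \<Sum>l\<le>n. of_real (fk_coeff k * fk_coeff l / fk_total) *
      (LINT s|circle_measure. cis (of_int (int k - int l) * s) * f s))"
proof -
  interpret finite_measure circle_measure by (rule finite_circle_measure)
  define C where "C k l = complex_of_real (fk_coeff k * fk_coeff l / fk_total)" for k l
  have i: "integrable circle_measure (\<lambda>s. cis (of_int m * s) * f s)" for m
    by (rule integrable_const_bound[of _ B]) (auto simp: norm_mult B)
  have "(LINT s|fk_measure. f s) = (LINT s|circle_measure. complex_of_real (fk_kernel s) * f s)"
    unfolding fk_measure_def
    by (subst integral_density) (auto simp: fk_kernel_nonneg scaleR_conv_of_real)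
  also have "\<dots> = (LINT s|circle_measure. (\<Sum>k\<le>n. \<Sum>l\<le>n. C k l * (cis (of_int (int k - int l) * s) * f s)))"
    unfolding fk_kernel_expand C_def by (simp only: sum_distrib_right mult.assoc)
  also have "\<dots> = (\<Sum>k\<le>n. \<Sum>l\<le>n. C k l * (LINT s|circle_measure. cis (of_int (int k - int l) * s) * f s))"
    using i by (simp del: of_int_diff)
  finally show ?thesis by (simp only: C_def)
qed

text \<open>The eigenvector equation of the path, with eigenvalue twice the cosine of
  \<open>pi / real (n + 2)\<close>.\<close>

lemma fk_coeff_recurrence:
  "fk_coeff (k + 2) + fk_coeff k = 2 * cos (pi / real (n + 2)) * fk_coeff (k + 1)"
proof -
  define t where "t = pi / real (n + 2)"
  have "fk_coeff j = sin (real (j + 1) * t)" for j by (simp add: fk_coeff_def t_def)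
  moreover have "sin (real (k + 2 + 1) * t) + sin (real (k + 1) * t) = 2 * cos t * sin (real (k + 1 + 1) * t)"
  proof -
    have "real (k + 2 + 1) * t = real (k + 1 + 1) * t + t" "real (k + 1) * t = real (k + 1 + 1) * t - t"
      by (simp_all add: algebra_simps)
    then show ?thesis by (simp only: sin_add sin_diff) simp
  qed
  ultimately show ?thesis by (simp add: t_def)
qed

lemma fk_correlation: "(\<Sum>k<n. fk_coeff k * fk_coeff (k + 1)) = cos (pi / real (n + 2)) * fk_total"
proof -
  define t where "t = cos (pi / real (n + 2))"
  have last: "fk_coeff (n + 1) = 0"
  proof -
    have "real (n + 1 + 1) * pi / real (n + 2) = pi" by (simp add: field_simps)
    then show ?thesis unfolding fk_coeff_def by (simp only: sin_pi)
  qed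
  have first: "fk_coeff 1 = 2 * t * fk_coeff 0"
    unfolding fk_coeff_def t_def using sin_double[of "pi / real (n + 2)"] by (simp add: mult_ac)
  \<comment> \<open>Summing the eigenvector equation against the coefficients leaves one boundary
    term, which vanishes for \<open>m = n\<close> because \<open>fk_coeff (n + 1)\<close> is the
    sine of pi.\<close>
  have "(\<Sum>k<Suc m. (fk_coeff k)\<^sup>2) * (2 * t) = 2 * (\<Sum>k<m. fk_coeff k * fk_coeff (k + 1)) + fk_coeff m * fk_coeff (m + 1)" for m
  proof (induction m)
    case 0
    then show ?case using first by (simp add: power2_eq_square)
  next
    case (Suc m)
    have "(fk_coeff (Suc m))\<^sup>2 * (2 * t) = fk_coeff (Suc m) * (fk_coeff (m + 2) + fk_coeff m)"
      using fk_coeff_recurrence[of m] by (simp add: t_def power2_eq_square)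
    then show ?case using Suc by (simp add: algebra_simps)
  qed
  from this[of n] show ?thesis
    using last by (simp add: fk_total_def lessThan_Suc_atMost t_def algebra_simps)
qed

lemma finite_fk_measure: "finite_measure fk_measure"
proof (rule finite_measureI)
  interpret finite_measure circle_measure by (rule finite_circle_measure)
  have "fk_kernel s \<le> (\<Sum>k\<le>n. \<bar>fk_coeff k\<bar>)\<^sup>2 / fk_total" for s
    unfolding fk_kernel_def using fk_total_pos
    by (intro divide_right_mono power_mono order_trans[OF norm_sum]) (auto simp: norm_mult)
  then have "integrable circle_measure fk_kernel"
    by (intro integrable_const_bound[of _ "(\<Sum>k\<le>n. \<bar>fk_coeff k\<bar>)\<^sup>2 / fk_total"]) (auto simp: fk_kernel_nonneg)
  moreover have "emeasure fk_measure (space fk_measure) = (\<integral>\<^sup>+s. ennreal (fk_kernel s) \<partial>circle_measure)"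
    unfolding fk_measure_def by (subst emeasure_density) auto
  ultimately show "emeasure fk_measure (space fk_measure) \<noteq> \<infinity>"
    by (simp add: nn_integral_eq_integral fk_kernel_nonneg)
qed

lemma measure_fk_measure: "measure fk_measure UNIV = 1"
proof -
  interpret finite_measure fk_measure by (rule finite_fk_measure)
  have "complex_of_real (measure fk_measure UNIV) = (LINT s|fk_measure. 1)"
    by (simp add: scaleR_conv_of_real)
  also have "\<dots> = (\<Sum>k\<le>n. \<Sum>l\<le>n. of_real (fk_coeff k * fk_coeff l / fk_total) * (if int k - int l = 0 then 1 else 0))"
    by (subst integral_fk_measure[where B=1]) (simp_all only: borel_measurable_const mult_1_right integral_cis norm_one order_refl)
  also have "\<dots> = (\<Sum>k\<le>n. \<Sum>l\<le>n. if k = l then of_real (fk_coeff k * fk_coeff l / fk_total) else 0)"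
    by (intro sum.cong refl) simp
  also have "\<dots> = of_real ((\<Sum>k\<le>n. (fk_coeff k)\<^sup>2) / fk_total)"
    by (simp add: sum_divide_distrib power2_eq_square)
  also have "\<dots> = 1" using fk_total_pos by (simp add: fk_total_def)
  finally show ?thesis by (simp only: of_real_eq_1_iff)
qed

text \<open>Multiplication by \<open>cis s\<close> shifts frequencies by one, so only the terms with
  \<open>l = k + 1\<close> survive; they form the correlation sum.\<close>

lemma integral_cos_fk_measure: "(LINT s|fk_measure. cos s) = cos (pi / real (n + 2))"
proof -
  interpret finite_measure fk_measure by (rule finite_fk_measure)
  have i: "integrable fk_measure (\<lambda>s. cis s)"
    by (rule integrable_const_bound[of _ 1]) auto
  have "(LINT s|fk_measure. cis s) = (\<Sum>k\<le>n. \<Sum>l\<le>n. of_real (fk_coeff k * fk_coeff l / fk_total) * (if int k - int l + 1 = 0 then 1 else 0))"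
  proof (subst integral_fk_measure[where B=1])
    have "cis (of_int m * s) * cis s = cis (of_int (m + 1) * s)" for m s
      by (simp add: cis_mult algebra_simps)
    then show "(\<Sum>k\<le>n. \<Sum>l\<le>n. of_real (fk_coeff k * fk_coeff l / fk_total) * (LINT s|circle_measure. cis (of_int (int k - int l) * s) * cis s))
       = (\<Sum>k\<le>n. \<Sum>l\<le>n. of_real (fk_coeff k * fk_coeff l / fk_total) * (if int k - int l + 1 = 0 then 1 else 0))"
      by (simp only: integral_cis)
  qed auto
  also have "\<dots> = (\<Sum>k\<le>n. \<Sum>l\<le>n. if l = k + 1 then of_real (fk_coeff k * fk_coeff l / fk_total) else 0)"
    by (intro sum.cong refl) auto
  also have "\<dots> = (\<Sum>k\<le>n. if k < n then of_real (fk_coeff k * fk_coeff (k + 1) / fk_total) else 0)"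
    by (intro sum.cong refl) (auto simp: sum.delta)
  also have "\<dots> = (\<Sum>k<n. of_real (fk_coeff k * fk_coeff (k + 1) / fk_total))"
    by (intro sum.mono_neutral_cong_right) auto
  also have "\<dots> = of_real ((\<Sum>k<n. fk_coeff k * fk_coeff (k + 1)) / fk_total)"
    by (simp add: sum_divide_distrib)
  also have "\<dots> = of_real (cos (pi / real (n + 2)))"
    using fk_total_pos by (simp only: fk_correlation) simp
  finally have "Re (LINT s|fk_measure. cis s) = cos (pi / real (n + 2))" by simp
  then show ?thesis using integral_Re[OF i] by simp
qed

lemma AE_fk_measure: "AE s in fk_measure. \<bar>s\<bar> \<le> pi"
proof -
  have "AE s in circle_measure. \<bar>s\<bar> \<le> pi"
    unfolding circle_measure_def by (subst AE_density) (auto split: split_indicator)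
  then show ?thesis
    unfolding fk_measure_def by (subst AE_density) (auto elim: eventually_mono)
qed

text \<open>The square is at most \<open>pi\<^sup>2 / 2 * (1 - cos s)\<close>, and the mean of the
  cosine differs from 1 by at most half the square of \<open>pi / real (n + 2)\<close>. This is the
  origin of the constant pi^2/2 in the error bounds.\<close>

lemma
  shows integrable_square_fk_measure: "integrable fk_measure (\<lambda>s. s\<^sup>2)"
    and integral_square_fk_measure: "(LINT s|fk_measure. s\<^sup>2) \<le> (pi\<^sup>2 / (2 * real (n + 2)))\<^sup>2"
proof -
  interpret finite_measure fk_measure by (rule finite_fk_measure)
  have "AE s in fk_measure. norm (s\<^sup>2) \<le> pi\<^sup>2"
    using AE_fk_measure by eventually_elim (simp add: abs_le_square_iff[symmetric])
  then show i: "integrable fk_measure (\<lambda>s. s\<^sup>2)"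
    by (intro integrable_const_bound[of _ "pi\<^sup>2"]) auto
  have ic: "integrable fk_measure cos"
    by (intro integrable_const_bound[of _ 1]) auto
  have "(LINT s|fk_measure. s\<^sup>2) \<le> (LINT s|fk_measure. pi\<^sup>2 / 2 * (1 - cos s))"
  proof (rule integral_mono_AE[OF i])
    show "AE s in fk_measure. s\<^sup>2 \<le> pi\<^sup>2 / 2 * (1 - cos s)"
      using AE_fk_measure by eventually_elim (rule square_le_one_minus_cos)
  qed (use ic in simp)
  also have "\<dots> = pi\<^sup>2 / 2 * (1 - cos (pi / real (n + 2)))"
    using ic by (simp add: integral_cos_fk_measure measure_fk_measure)
  also have "\<dots> \<le> pi\<^sup>2 / 2 * ((pi / real (n + 2))\<^sup>2 / 2)"
    by (intro mult_left_mono one_minus_cos_le) auto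
  also have "pi\<^sup>2 / 2 * ((pi / r)\<^sup>2 / 2) = (pi\<^sup>2 / (2 * r))\<^sup>2" for r :: real
    by (simp add: power_divide power_mult_distrib power2_eq_square mult_ac)
  finally show "(LINT s|fk_measure. s\<^sup>2) \<le> (pi\<^sup>2 / (2 * real (n + 2)))\<^sup>2" .
qed

lemma fk_kernel_uminus: "fk_kernel (- s) = fk_kernel s"
proof -
  have "(\<Sum>k\<le>n. of_real (fk_coeff k) * cis (real k * (- s))) = cnj (\<Sum>k\<le>n. of_real (fk_coeff k) * cis (real k * s))"
    by (simp add: cis_cnj)
  then show ?thesis unfolding fk_kernel_def by (simp only: complex_mod_cnj)
qed

text \<open>Evenness of the kernel: an average of \<open>g s\<close> is half the average of
  \<open>g s + g (- s)\<close>, the form in which second differences enter.\<close>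

lemma integral_uminus_fk_measure:
  fixes g :: "real \<Rightarrow> real"
  assumes [measurable]: "g \<in> borel_measurable borel"
  shows "(LINT s|fk_measure. g (- s)) = (LINT s|fk_measure. g s)"
proof -
  have I: "(LINT s|fk_measure. h s) = (LINT s|lborel. indicator {-pi..pi} s / (2 * pi) * (fk_kernel s * h s))"
    if [measurable]: "h \<in> borel_measurable borel" for h :: "real \<Rightarrow> real"
    unfolding fk_measure_def
    by (subst integral_density)
      (auto simp: fk_kernel_nonneg circle_measure_def integral_density)
  show ?thesis
    by (simp add: I) (subst lborel_integral_real_affine[of "-1" _ 0],
      auto simp: fk_kernel_uminus intro!: Bochner_Integration.integral_cong split: split_indicator)
qed

text \<open>Each frequency \<open>k - l\<close> of the kernel selects the Taylor term of degree
  \<open>l - k\<close>, at most \<open>n\<close>, or nothing when \<open>k > l\<close>. Agreement is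
  claimed on the disc only, since F is arbitrary outside it.\<close>

lemma fk_average_is_polynomial:
  assumes F: "F holomorphic_on ball 0 1"
  obtains P where "degree P \<le> n" "\<And>z. z \<in> ball 0 1 \<Longrightarrow> (LINT s|fk_measure. F (cis s * z)) = poly P z"
proof
  define P where "P = (\<Sum>k\<le>n. \<Sum>l\<le>n. if k \<le> l then
      monom (of_real (fk_coeff k * fk_coeff l / fk_total) * ((deriv ^^ (l - k)) F 0 / fact (l - k))) (l - k) else 0)"
  show "degree P \<le> n"
    unfolding P_def
    by (intro degree_sum_le) (auto intro: order_trans[OF degree_monom_le])
  fix z :: complex assume z: "z \<in> ball 0 1"
  have sub: "sphere 0 (cmod z) \<subseteq> ball 0 1" using z by auto
  have cont: "continuous_on (sphere 0 (cmod z)) F"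
    using F sub by (meson continuous_on_subset holomorphic_on_imp_continuous_on)
  then have "compact (F ` sphere 0 (cmod z))"
    by (intro compact_continuous_image) auto
  then obtain B where B: "\<And>w. w \<in> sphere 0 (cmod z) \<Longrightarrow> cmod (F w) \<le> B"
    using compact_imp_bounded bounded_iff by (metis imageI)
  have m: "(\<lambda>s. F (cis s * z)) \<in> borel_measurable borel"
    by (rule borel_measurable_continuous_onI, rule continuous_on_compose2[OF cont])
      (auto intro!: continuous_intros simp: norm_mult)
  have "(LINT s|fk_measure. F (cis s * z)) = (\<Sum>k\<le>n. \<Sum>l\<le>n. of_real (fk_coeff k * fk_coeff l / fk_total) *
      (LINT s|circle_measure. cis (of_int (int k - int l) * s) * F (cis s * z)))"
    by (rule integral_fk_measure[OF m, of B]) (auto intro!: B simp: norm_mult)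
  also have "\<dots> = poly P z"
  proof -
    have "nat (- (int k - int l)) = l - k" "int k - int l \<le> 0 \<longleftrightarrow> k \<le> l" for k l by auto
    then show ?thesis
      unfolding P_def poly_sum fourier_coefficient_holomorphic[OF F z]
      by (intro sum.cong refl) (simp add: poly_monom mult_ac)
  qed
  finally show "(LINT s|fk_measure. F (cis s * z)) = poly P z" .
qed

end

section \<open>The constants\<close>

lemma sin_ge_cubic:
  fixes x :: real
  assumes "0 \<le> x"
  shows "x - x ^ 3 / 6 \<le> sin x"
proof -
  define f where "f = (\<lambda>x::real. sin x - x + x ^ 3 / 6)"
  have "f 0 \<le> f x"
  proof (rule DERIV_nonneg_imp_nondecreasing[OF assms])
    fix y :: real
    have "(f has_real_derivative (cos y - 1 + y\<^sup>2 / 2)) (at y)"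
      unfolding f_def by (auto intro!: derivative_eq_intros simp: power2_eq_square)
    then show "\<exists>d. (f has_real_derivative d) (at y) \<and> 0 \<le> d"
      using one_minus_cos_le[of y] by (intro exI[of _ "cos y - 1 + y\<^sup>2 / 2"]) auto
  qed
  then show ?thesis by (simp add: f_def)
qed

text \<open>0.527 is 3.162 / 6, and the cubic bound already puts its sine above 1/2, the sine of
  pi/6.\<close>

lemma pi_less_3162: "pi < 3.162"
proof (rule ccontr)
  assume "\<not> ?thesis"
  then have "sin (0.527 :: real) \<le> sin (pi / 6)"
    using pi_less_4 by (intro sin_monotone_2pi_le) auto
  moreover have "(0.527 :: real) - 0.527 ^ 3 / 6 \<le> sin 0.527"
    by (rule sin_ge_cubic) simp
  ultimately show False by (simp add: sin_30 power3_eq_cube)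
qed

text \<open>The difference factors as \<open>(1 - cos t) * (1 + 2 * cos t)\<close>. Bounding the
  factors below by t^2/2 - t^4/24 and 3 - t^2, both nonnegative on this range, and dropping t^6/24
  gives the claim.\<close>

lemma cos_diff_double_ge:
  fixes t :: real
  assumes "0 \<le> t" "t \<le> 3 / 2"
  shows "3 / 2 * t\<^sup>2 - 5 / 8 * t ^ 4 \<le> cos t - cos (2 * t)"
proof -
  have t2: "t\<^sup>2 \<le> 9 / 4"
    using power_mono[of t "3/2" 2] assms by (simp add: power2_eq_square)
  have "0 \<le> t / 2 - (t / 2) ^ 3 / 6"
  proof -
    have "t / 2 - (t / 2) ^ 3 / 6 = t / 2 * (1 - t\<^sup>2 / 24)"
      by (simp add: power2_eq_square power3_eq_cube algebra_simps)
    also have "0 \<le> \<dots>" using assms t2 by (intro mult_nonneg_nonneg) auto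
    finally show ?thesis .
  qed
  then have "(t / 2 - (t / 2) ^ 3 / 6)\<^sup>2 \<le> (sin (t / 2))\<^sup>2"
    using assms by (intro power_mono sin_ge_cubic) auto
  moreover have c: "cos t = 1 - 2 * (sin (t / 2))\<^sup>2"
    using cos_double_sin[of "t / 2"] by simp
  moreover have "t\<^sup>2 / 2 - t ^ 4 / 24 \<le> 2 * (t / 2 - (t / 2) ^ 3 / 6)\<^sup>2"
  proof -
    have "2 * (t / 2 - (t / 2) ^ 3 / 6)\<^sup>2 = t\<^sup>2 / 2 - t ^ 4 / 24 + t ^ 6 / 1152"
      by (simp add: field_simps power2_eq_square power3_eq_cube power_numeral_reduce)
    then show ?thesis by simp
  qed
  ultimately have a: "t\<^sup>2 / 2 - t ^ 4 / 24 \<le> 1 - cos t" by linarith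
  have b: "3 - t\<^sup>2 \<le> 1 + 2 * cos t" using one_minus_cos_le[of t] by simp
  have "t ^ 4 \<le> 9 / 4 * t\<^sup>2"
    using mult_right_mono[OF t2, of "t\<^sup>2"] by (simp add: power2_eq_square power4_eq_xxxx mult.assoc)
  then have "0 \<le> t\<^sup>2 / 2 - t ^ 4 / 24" using zero_le_power2[of t] by linarith
  then have "(t\<^sup>2 / 2 - t ^ 4 / 24) * (3 - t\<^sup>2) \<le> (1 - cos t) * (1 + 2 * cos t)"
    using a b t2 by (intro mult_mono) auto
  moreover have "(t\<^sup>2 / 2 - t ^ 4 / 24) * (3 - t\<^sup>2) = 3 / 2 * t\<^sup>2 - 5 / 8 * t ^ 4 + t ^ 6 / 24"
    by (simp add: field_simps power2_eq_square power_numeral_reduce)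
  moreover have "(1 - cos t) * (1 + 2 * cos t) = cos t - cos (2 * t)"
    unfolding cos_double_cos by (simp add: power2_eq_square algebra_simps)
  moreover have "0 \<le> t ^ 6 / 24" by simp
  ultimately show ?thesis by linarith
qed

lemma abs_cos_diff_double_le: "\<bar>cos t - cos (2 * t)\<bar> \<le> 5 / 2 * t\<^sup>2" for t :: real
proof -
  have "\<bar>cos t - cos (2 * t)\<bar> \<le> (1 - cos t) + (1 - cos (2 * t))"
    using cos_le_one[of t] cos_le_one[of "2 * t"] by (simp only: abs_le_iff) linarith
  also have "\<dots> \<le> t\<^sup>2 / 2 + (2 * t)\<^sup>2 / 2" by (intro add_mono one_minus_cos_le)
  finally show ?thesis by simp
qed

text \<open>The difference of cosines vanishes to second order at 0, which bounds the integrand on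
  \<open>{0..1}\<close>; beyond 1 it is at most \<open>2 * t powr (\<gamma> - 2)\<close>, integrable
  because \<open>\<gamma> < 1\<close>.\<close>

lemma set_integrable_cos_powr:
  fixes \<gamma> :: real
  assumes g: "0 \<le> \<gamma>" "\<gamma> < 1"
  shows "set_integrable lborel {0<..} (\<lambda>t. \<bar>cos t - cos (2 * t)\<bar> * t powr (\<gamma> - 2))"
  unfolding set_integrable_def
proof (rule Bochner_Integration.integrable_bound)
  have "(\<lambda>t. t powr (\<gamma> - 2)) absolutely_integrable_on {1..}"
    using has_integral_powr_to_inf[of "\<gamma> - 2" 1] g
    by (intro nonnegative_absolutely_integrable_1) (auto simp: integrable_on_def)
  then have i: "integrable lborel (\<lambda>t::real. indicator {1..} t * t powr (\<gamma> - 2))"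
    unfolding set_integrable_def real_scaleR_def by (subst (asm) integrable_completion) auto
  have j: "integrable lborel (\<lambda>t::real. indicator {0..1} t :: real)"
    by (intro integrable_real_indicator) auto
  show "integrable lborel (\<lambda>t::real. 5 / 2 * indicator {0..1} t + 2 * (indicator {1..} t * t powr (\<gamma> - 2)))"
    using i j by simp
  have bd: "\<bar>cos t - cos (2 * t)\<bar> * t powr (\<gamma> - 2) \<le> 5 / 2 * indicator {0..1} t + 2 * (indicator {1..} t * t powr (\<gamma> - 2))"
    if t: "0 < t" for t :: real
  proof (cases "t \<le> 1")
    case True
    have "\<bar>cos t - cos (2 * t)\<bar> * t powr (\<gamma> - 2) \<le> (5 / 2 * t\<^sup>2) * t powr (\<gamma> - 2)"
      by (intro mult_right_mono abs_cos_diff_double_le) auto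
    also have "\<dots> = 5 / 2 * (t powr 2 * t powr (\<gamma> - 2))" using t by simp
    also have "t powr 2 * t powr (\<gamma> - 2) = t powr \<gamma>" by (subst powr_add[symmetric]) simp
    also have "t powr \<gamma> \<le> 1" using t True g by (intro powr_le1) auto
    finally have "\<bar>cos t - cos (2 * t)\<bar> * t powr (\<gamma> - 2) \<le> 5 / 2" by simp
    also have "\<dots> \<le> 5 / 2 * indicator {0..1} t + 2 * (indicator {1..} t * t powr (\<gamma> - 2))"
      using True t by (simp add: indicator_def)
    finally show ?thesis .
  next
    case False
    have "\<bar>cos t - cos (2 * t)\<bar> \<le> 2"
      using cos_le_one[of t] cos_le_one[of "2 * t"] cos_ge_minus_one[of t] cos_ge_minus_one[of "2 * t"]
      by (simp only: abs_le_iff) linarith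
    then show ?thesis using False by (simp add: indicator_def)
  qed
  show "AE t in lborel. norm (indicat_real {0<..} t *\<^sub>R (\<bar>cos t - cos (2 * t)\<bar> * t powr (\<gamma> - 2)))
     \<le> norm (5 / 2 * indicator {0..1} t + 2 * (indicator {1..} t * t powr (\<gamma> - 2)))"
  proof (rule AE_I2)
    fix t :: real
    show "norm (indicat_real {0<..} t *\<^sub>R (\<bar>cos t - cos (2 * t)\<bar> * t powr (\<gamma> - 2)))
     \<le> norm (5 / 2 * indicator {0..1} t + 2 * (indicator {1..} t * t powr (\<gamma> - 2)))"
      using bd[of t] by (cases "0 < t") (auto intro: order_trans[OF _ abs_ge_self])
  qed
qed measurable

text \<open>\<open>t powr \<gamma>\<close> is at least t - t^2/4 for every admissible exponent: for
  t <= 1 it is at least t, for t > 1 at least 1. So one polynomial minorant \<open>h\<close> on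
  \<open>{0..3/2}\<close> serves all exponents. \<open>H\<close> is its antiderivative, and 0.7119
  is \<open>H (3/2)\<close> rounded down.\<close>

lemma LINT_cos_powr_ge:
  fixes \<gamma> :: real
  assumes g: "0 \<le> \<gamma>" "\<gamma> < 1"
  shows "0.7119 \<le> (LINT t:{0<..}|lborel. \<bar>cos t - cos (2 * t)\<bar> * t powr (\<gamma> - 2))"
proof -
  define h where "h t = (3 / 2 - 5 / 8 * t\<^sup>2) * (t - t\<^sup>2 / 4)" for t :: real
  define H where "H t = 3 / 4 * t\<^sup>2 - t ^ 3 / 8 - 5 / 32 * t ^ 4 + t ^ 5 / 32" for t :: real
  have cont: "continuous_on {0..3/2} h" unfolding h_def by (intro continuous_intros) auto
  have hi: "integrable lborel (\<lambda>t. indicator {0..3/2} t *\<^sub>R h t)"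
    using borel_integrable_atLeastAtMost'[OF cont] by (simp add: set_integrable_def)
  have "0.7119 \<le> H (3/2) - H 0" by (simp add: H_def power_numeral_reduce)
  also have "H (3/2) - H 0 = (LINT t|lborel. indicator {0..3/2} t *\<^sub>R h t)"
  proof (rule integral_FTC_atLeastAtMost[symmetric])
    fix x :: real
    have "(H has_real_derivative h x) (at x within {0..3/2})"
      unfolding H_def h_def
      by (auto intro!: derivative_eq_intros simp: field_simps power2_eq_square power3_eq_cube power4_eq_xxxx)
    then show "(H has_vector_derivative h x) (at x within {0..3/2})"
      by (simp add: has_real_derivative_iff_has_vector_derivative)
  qed (use cont in auto)
  also have "\<dots> \<le> (LINT t|lborel. indicator {0<..} t *\<^sub>R (\<bar>cos t - cos (2 * t)\<bar> * t powr (\<gamma> - 2)))"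
  proof (rule integral_mono[OF hi])
    show "integrable lborel (\<lambda>t. indicator {0<..} t *\<^sub>R (\<bar>cos t - cos (2 * t)\<bar> * t powr (\<gamma> - 2)))"
      using set_integrable_cos_powr[OF g] by (simp add: set_integrable_def)
    fix t :: real
    show "indicator {0..3/2} t *\<^sub>R h t \<le> indicator {0<..} t *\<^sub>R (\<bar>cos t - cos (2 * t)\<bar> * t powr (\<gamma> - 2))"
    proof (cases "0 < t \<and> t \<le> 3/2")
      case True
      then have t: "0 < t" "t \<le> 3/2" by auto
      have w: "t - t\<^sup>2 / 4 \<le> t powr \<gamma>"
      proof (cases "t \<le> 1")
        case True
        then have "t powr 1 \<le> t powr \<gamma>" using t g by (intro powr_mono') auto
        then have "t \<le> t powr \<gamma>" using t by simp
        moreover have "t - t\<^sup>2 / 4 \<le> t" by simp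
        ultimately show ?thesis by linarith
      next
        case False
        have "0 \<le> (1 - t / 2)\<^sup>2" by simp
        then have "t - t\<^sup>2 / 4 \<le> 1" by (simp add: power2_eq_square algebra_simps)
        also have "1 \<le> t powr \<gamma>" using False g by (intro ge_one_powr_ge_zero) auto
        finally show ?thesis .
      qed
      have t2: "t\<^sup>2 \<le> 9 / 4"
        using power_mono[of t "3/2" 2] t by (simp add: power2_eq_square)
      have "h t \<le> (3 / 2 - 5 / 8 * t\<^sup>2) * t powr \<gamma>"
        unfolding h_def using w t2 by (intro mult_left_mono) auto
      also have "t powr \<gamma> = t\<^sup>2 * t powr (\<gamma> - 2)"
        using t powr_add[of t 2 "\<gamma> - 2"] by simp
      also have "(3 / 2 - 5 / 8 * t\<^sup>2) * (t\<^sup>2 * t powr (\<gamma> - 2)) = (3 / 2 * t\<^sup>2 - 5 / 8 * t ^ 4) * t powr (\<gamma> - 2)"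
        by (simp add: algebra_simps power2_eq_square power4_eq_xxxx)
      also have "\<dots> \<le> \<bar>cos t - cos (2 * t)\<bar> * t powr (\<gamma> - 2)"
        using cos_diff_double_ge[of t] t by (intro mult_right_mono) auto
      finally show ?thesis using t by (simp add: indicator_def)
    next
      case False
      then show ?thesis by (auto simp: indicator_def h_def)
    qed
  qed
  finally show ?thesis by (simp add: set_lebesgue_integral_def)
qed

lemma pi_cubed_le: "pi ^ 3 \<le> 31.7"
proof -
  have "pi ^ 3 \<le> 3.162 ^ 3" using pi_less_3162 by (intro power_mono) auto
  then show ?thesis by (simp add: power3_eq_cube)
qed

text \<open>Taking out \<open>2 powr \<gamma>\<close> leaves a power of pi^2/4, at most pi^2/4
  itself because that base is at least 1. It remains to see that pi^3/4 <= 8 sqrt 2 I; after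
  rounding this is 7.925 against about 8.05, so pi and the integral must be known rather precisely.
  The factor 4 sqrt 2 is the one that \<open>rate_lt_2\<close> demands.\<close>

lemma A_const_lower_bound:
  fixes \<gamma> :: real
  assumes g: "0 \<le> \<gamma>" "\<gamma> < 1"
  shows "(pi\<^sup>2 / 2) powr \<gamma> \<le> 4 * sqrt 2 * A_const \<gamma>"
proof -
  define I where "I = (LINT t:{0<..}|lborel. \<bar>cos t - cos (2 * t)\<bar> * t powr (\<gamma> - 2))"
  have I: "0.7119 \<le> I" unfolding I_def by (rule LINT_cos_powr_ge[OF g])
  have s2: "1.414 \<le> sqrt (2::real)" by (rule real_le_rsqrt) (simp add: power2_eq_square)
  have "1 \<le> pi\<^sup>2 / 4" using power_mono[of 2 pi 2] pi_ge_two by simp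
  then have "(pi\<^sup>2 / 4) powr \<gamma> \<le> (pi\<^sup>2 / 4) powr 1" using g by (intro powr_mono) auto
  then have "pi * (pi\<^sup>2 / 4) powr \<gamma> \<le> pi * (pi\<^sup>2 / 4)" by (intro mult_left_mono) auto
  also have "\<dots> = pi ^ 3 / 4" by (simp add: power2_eq_square power3_eq_cube)
  also have "\<dots> \<le> 31.7 / 4" using pi_cubed_le by simp
  also have "\<dots> \<le> 8 * 1.414 * 0.7119" by simp
  also have "\<dots> \<le> 8 * sqrt 2 * I" using s2 I by (intro mult_mono) auto
  finally have "(pi\<^sup>2 / 4) powr \<gamma> \<le> 8 * sqrt 2 * I / pi" by (simp add: field_simps)
  then have "2 powr \<gamma> * (pi\<^sup>2 / 4) powr \<gamma> \<le> 2 powr \<gamma> * (8 * sqrt 2 * I / pi)" by (intro mult_left_mono) auto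
  moreover have "2 powr \<gamma> * (pi\<^sup>2 / 4) powr \<gamma> = (pi\<^sup>2 / 2) powr \<gamma>"
    by (subst powr_mult[symmetric]) auto
  moreover have "2 powr \<gamma> * (8 * sqrt 2 * I / pi) = 4 * sqrt 2 * A_const \<gamma>"
    by (simp add: A_const_def I_def powr_add)
  ultimately show ?thesis by simp
qed

text \<open>\<open>pi * C_const 0\<close> is twice the integral with exponent parameter 0, hence at
  least 1.4238, and \<open>C_const 2\<close> is nonnegative as an integral of an absolute
  value.\<close>

lemma B_tilde_0_lower_bound: "pi\<^sup>2 / 2 \<le> 4 * sqrt 2 * B_tilde_0"
proof -
  define I where "I = (LINT t:{0::real<..}|lborel. \<bar>cos t - cos (2 * t)\<bar> * t powr (0 - 2))"
  have I: "0.7119 \<le> I" unfolding I_def by (rule LINT_cos_powr_ge) auto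
  have "(LINT t:{0<..}|lborel. \<bar>H_fun 0 t\<bar>) = (LINT t:{0<..}|lborel. (1/2) * (\<bar>cos t - cos (2 * t)\<bar> * t powr (0 - 2)))"
  proof (rule set_lebesgue_integral_cong)
    have "\<bar>H_fun 0 t\<bar> = (1/2) * (\<bar>cos t - cos (2 * t)\<bar> * t powr (0 - 2))" if "0 < t" for t
    proof -
      have "t powr (0 - 2) = 1 / t\<^sup>2" using powr_minus[of t 2] that by (simp add: divide_inverse)
      then show ?thesis by (simp add: abs_divide)
    qed
    then show "\<forall>t. t \<in> {0<..} \<longrightarrow> \<bar>H_fun 0 t\<bar> = (1/2) * (\<bar>cos t - cos (2 * t)\<bar> * t powr (0 - 2))"
      by simp
  qed simp
  then have C0: "pi * C_const 0 = 2 * I"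
    by (simp add: C_const_def I_def)
  have "0 \<le> C_const 2"
    unfolding C_const_def set_lebesgue_integral_def by (intro mult_nonneg_nonneg integral_nonneg_AE) auto
  then have "2 * I \<le> B_tilde_0" by (simp add: B_tilde_0_def C0)
  then have B: "1.4238 \<le> B_tilde_0" using I by simp
  have s2: "1.414 \<le> sqrt (2::real)" by (rule real_le_rsqrt) (simp add: power2_eq_square)
  have "pi\<^sup>2 \<le> 3.162\<^sup>2" using pi_less_3162 by (intro power_mono) auto
  then have "pi\<^sup>2 / 2 \<le> 4 * 1.414 * 1.4238" by (simp add: power2_eq_square)
  also have "\<dots> \<le> 4 * sqrt 2 * B_tilde_0" using s2 B by (intro mult_mono) auto
  finally show ?thesis .
qed

section \<open>Extremal problems\<close>

lemma AE_bergman_measure_nonzero: "AE z in bergman_measure \<alpha>. z \<noteq> 0"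
proof -
  have w: "(\<lambda>z. ennreal ((\<alpha> + 1) / pi * (1 - (cmod z)\<^sup>2) powr \<alpha>)) \<in> borel_measurable (restrict_space lborel (ball 0 1))"
    by (intro measurable_restrict_space1) measurable
  have "AE z in lborel. z \<noteq> (0::complex)" by (rule AE_lborel_singleton)
  then have "AE z in restrict_space lborel (ball 0 1). z \<noteq> (0::complex)"
    by (subst AE_restrict_space_iff) (auto elim: eventually_mono)
  then show ?thesis
    unfolding bergman_measure_def by (subst AE_density[OF w]) (auto elim: eventually_mono)
qed

text \<open>A second difference with step s is a combination, with weights 1, 2, 1, of second
  differences with step s/2. Each halving thus multiplies the bound by
  \<open>4 / 2 powr \<beta>\<close>, which is below 1, and iteration forces 0.\<close>

lemma zygmund_order_gt_2_affine:
  fixes \<psi> :: "real \<Rightarrow> complex"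
  assumes bound: "\<And>u s. cmod (\<psi> (u + s) + \<psi> (u - s) - 2 * \<psi> u) \<le> C * \<bar>s\<bar> powr \<beta>" and "2 < \<beta>"
  shows "\<psi> (u + s) + \<psi> (u - s) = 2 * \<psi> u"
proof -
  define x where "x = 4 / 2 powr \<beta>"
  have "2 powr 2 < 2 powr \<beta>" using \<open>2 < \<beta>\<close> by (intro powr_less_mono) auto
  then have x: "0 < x" "x < 1" by (auto simp: x_def)
  have it: "cmod (\<psi> (u + s) + \<psi> (u - s) - 2 * \<psi> u) \<le> C * x ^ m * \<bar>s\<bar> powr \<beta>" for m u s
  proof (induction m arbitrary: u s)
    case 0
    then show ?case using bound by simp
  next
    case (Suc m)
    define r where "r = s / 2"
    define D where "D v = \<psi> (v + r) + \<psi> (v - r) - 2 * \<psi> v" for v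
    have "\<psi> (u + s) + \<psi> (u - s) - 2 * \<psi> u = D (u + r) + 2 * D u + D (u - r)"
      unfolding D_def r_def by (simp add: algebra_simps)
    also have "cmod \<dots> \<le> cmod (D (u + r)) + 2 * cmod (D u) + cmod (D (u - r))"
      by (metis add_right_mono norm_mult norm_numeral norm_triangle_ineq norm_triangle_le)
    also have "\<dots> \<le> 4 * (C * x ^ m * \<bar>r\<bar> powr \<beta>)"
      using Suc[of "u + r" r] Suc[of u r] Suc[of "u - r" r] unfolding D_def by linarith
    also have "\<dots> = C * x ^ Suc m * \<bar>s\<bar> powr \<beta>"
      by (simp add: r_def x_def abs_divide powr_divide)
    finally show ?case .
  qed
  have "(\<lambda>m. C * x ^ m * \<bar>s\<bar> powr \<beta>) \<longlonglongrightarrow> C * 0 * \<bar>s\<bar> powr \<beta>"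
    using x by (intro tendsto_intros LIMSEQ_realpow_zero) auto
  then have "cmod (\<psi> (u + s) + \<psi> (u - s) - 2 * \<psi> u) \<le> C * 0 * \<bar>s\<bar> powr \<beta>"
    by (rule LIMSEQ_le_const) (use it in auto)
  then show ?thesis by simp
qed

context bergman_duality
begin

lemma bergman_space_bounded:
  assumes "f holomorphic_on ball 0 1" "\<And>z. z \<in> ball 0 1 \<Longrightarrow> cmod (f z) \<le> B" "0 \<le> r"
  shows "f \<in> bergman_space r \<alpha>"
proof -
  have [measurable]: "f \<in> borel_measurable \<mu>" using assms(1) by (rule holomorphic_measurable_bergman)
  have "integrable \<mu> (\<lambda>z. cmod (f z) powr r)"
    by (rule integrable_const_bound[of _ "B powr r"]) (use assms in \<open>auto intro!: AE_I2 powr_mono2\<close>)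
  then show ?thesis using assms by (simp add: bergman_space_def)
qed

lemma bergman_space_power: "0 \<le> r \<Longrightarrow> (\<lambda>z. z ^ j) \<in> bergman_space r \<alpha>"
  by (rule bergman_space_bounded[of _ 1])
    (auto intro!: holomorphic_intros simp: norm_power power_le_one)

lemma poly_in_bergman_space: "0 \<le> r \<Longrightarrow> poly P \<in> bergman_space r \<alpha>"
proof -
  assume r: "0 \<le> r"
  have "compact (poly P ` cball 0 1)" by (intro compact_continuous_image continuous_intros) auto
  then obtain B where "\<And>w. w \<in> cball 0 1 \<Longrightarrow> cmod (poly P w) \<le> B"
    using compact_imp_bounded bounded_iff by (metis imageI)
  then show ?thesis
    using r by (intro bergman_space_bounded[of _ B]) (auto intro!: holomorphic_intros)
qed

text \<open>
  Averaging the rotations of \<open>k\<close> against \<open>e\<^sup>-\<^sup>i\<^sup>j\<^sup>s\<close> isolates its \<open>j\<close>-th Taylor term, so a \<open>k\<close> that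
  annihilates all monomials has no Taylor coefficients.
\<close>

lemma functional_nontrivial:
  assumes k: "k \<in> bergman_space q \<alpha>" and nz: "\<exists>z\<in>ball 0 1. k z \<noteq> 0"
    and pos: "\<not> (AE z in \<mu>. False)"
  shows "\<exists>j. bergman_functional \<alpha> k (\<lambda>z. z ^ j) \<noteq> 0"
proof (rule ccontr)
  assume "\<not> ?thesis"
  then have zero: "bergman_functional \<alpha> k (\<lambda>z. z ^ j) = 0" for j by simp
  \<comment> \<open>Roles exchanged: \<open>k\<close> becomes the function that is averaged and the
    monomial becomes the kernel.\<close>
  interpret dual: bergman_duality q p \<alpha>
    using p_gt_1 q_gt_1 conj_exp finite_bergman by unfold_locales auto
  have p0: "0 \<le> p" using p_gt_1 by simp
  have kh: "k holomorphic_on ball 0 1" by (rule bergman_spaceD(1)[OF k])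
  have coeff: "(deriv ^^ j) k 0 / fact j = 0" for j
  proof -
    define c where "c = (deriv ^^ j) k 0 / fact j"
    note mj = bergman_space_power[OF p0, of j]
    \<comment> \<open>Moved onto the monomial, the rotation is a scalar factor, so the pairing is a
      multiple of the conjugate of a value that is 0 by \<open>zero\<close>.\<close>
    have rot0: "bergman_functional \<alpha> (\<lambda>z. z ^ j) (\<lambda>z. k (cis s * z)) = 0" for s
    proof -
      have "bergman_functional \<alpha> (\<lambda>z. z ^ j) (\<lambda>z. k (cis s * z)) = (LINT z|\<mu>. k z * cnj ((cis (- s) * z) ^ j))"
        using bergman_functional_rotate[OF bergman_spaceD(3)[OF k] bergman_spaceD(3)[OF mj], of s]
        by (simp add: bergman_functional_def)
      also have "\<dots> = (LINT z|\<mu>. cnj (cis (- s) ^ j) * cnj (z ^ j * cnj (k z)))"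
        by (intro Bochner_Integration.integral_cong refl) (simp add: power_mult_distrib mult_ac)
      also have "\<dots> = cnj (cis (- s) ^ j) * cnj (bergman_functional \<alpha> k (\<lambda>z. z ^ j))"
        unfolding bergman_functional_def by (simp only: integral_mult_right_zero Bochner_Integration.integral_cnj)
      finally show ?thesis by (simp add: zero)
    qed
    have "bergman_functional \<alpha> (\<lambda>z. z ^ j) (\<lambda>z. LINT s|circle_measure. cis (of_int (- int j) * s) * k (cis s * z))
      = (LINT s|circle_measure. cis (of_int (- int j) * s) * bergman_functional \<alpha> (\<lambda>z. z ^ j) (\<lambda>z. k (cis s * z)))"
      by (rule dual.functional_average[of _ _ 1])
        (use k mj finite_circle_measure in auto)
    also have "\<dots> = 0" by (simp add: rot0)
    also have "bergman_functional \<alpha> (\<lambda>z. z ^ j) (\<lambda>z. LINT s|circle_measure. cis (of_int (- int j) * s) * k (cis s * z))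
      = (LINT z|\<mu>. c * of_real (cmod (z ^ j) powr 2))"
      unfolding bergman_functional_def
    proof (rule Bochner_Integration.integral_cong[OF refl])
      fix z assume "z \<in> space \<mu>"
      then have z: "z \<in> ball 0 1" by simp
      have "of_real (cmod (z ^ j) powr 2) = z ^ j * cnj (z ^ j)"
        using complex_norm_square[of "z ^ j"] by simp
      then show "(LINT s|circle_measure. cis (of_int (- int j) * s) * k (cis s * z)) * cnj (z ^ j) = c * of_real (cmod (z ^ j) powr 2)"
        unfolding fourier_coefficient_holomorphic[OF kh z] by (simp add: c_def)
    qed
    also have "\<dots> = c * of_real (LINT z|\<mu>. cmod (z ^ j) powr 2)"
      by (simp del: powr_numeral)
    finally have "c = 0 \<or> (LINT z|\<mu>. cmod (z ^ j) powr 2) = 0" by simp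
    \<comment> \<open>The monomial vanishes at most at the origin, a null set, and
      \<open>pos\<close> says that the measure is not zero.\<close>
    moreover have "(LINT z|\<mu>. cmod (z ^ j) powr 2) \<noteq> 0"
    proof
      assume "(LINT z|\<mu>. cmod (z ^ j) powr 2) = 0"
      moreover have "integrable \<mu> (\<lambda>z. cmod (z ^ j) powr 2)"
        using bergman_space_power[of 2 j] by (simp add: bergman_space_def)
      ultimately have "AE z in \<mu>. cmod (z ^ j) powr 2 = 0"
        by (subst (asm) integral_nonneg_eq_0_iff_AE) auto
      with AE_bergman_measure_nonzero[of \<alpha>] have "AE z in \<mu>. False"
        by eventually_elim simp
      then show False using pos by simp
    qed
    ultimately show ?thesis by (simp add: c_def)
  qed
  have "k z = 0" if "z \<in> ball 0 1" for z
    using holomorphic_power_series[OF kh that] sums_unique2[OF _ sums_zero] by (simp add: coeff)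
  then show False using nz by auto
qed

text \<open>A phase factor makes the value at \<open>f\<close> real and nonnegative, and scaling
  gives norm 1; so maximising the real part also bounds the modulus.\<close>

lemma norm_functional_le_extremal:
  assumes F: "extremal_function p \<alpha> k F" and k: "k \<in> bergman_space q \<alpha>" and f: "f \<in> bergman_space p \<alpha>"
  shows "cmod (bergman_functional \<alpha> k f) \<le> Re (bergman_functional \<alpha> k F) * bergman_norm p \<alpha> f"
proof (cases "bergman_norm p \<alpha> f = 0 \<or> bergman_functional \<alpha> k f = 0")
  case True
  then show ?thesis
  proof
    assume "bergman_norm p \<alpha> f = 0"
    then show ?thesis using norm_functional_le[OF f k] by simp
  next
    assume z: "bergman_functional \<alpha> k f = 0"
    \<comment> \<open>The negative of F is an admissible competitor, so the extremal value is
      nonnegative.\<close>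
    have "bergman_norm p \<alpha> (\<lambda>z. - 1 * F z) = 1"
      using F p_gt_1 by (simp only: bergman_norm_cmult) (simp add: extremal_function_def extremal_in_def)
    moreover have "(\<lambda>z. - 1 * F z) \<in> bergman_space p \<alpha>"
      using F by (intro bergman_space_cmult) (simp add: extremal_function_def extremal_in_def)
    ultimately have "Re (bergman_functional \<alpha> k (\<lambda>z. - 1 * F z)) \<le> Re (bergman_functional \<alpha> k F)"
      using F unfolding extremal_function_def extremal_in_def by blast
    then have "0 \<le> Re (bergman_functional \<alpha> k F)"
      unfolding bergman_functional_cmult by simp
    then show ?thesis using z bergman_norm_nonneg by simp
  qed
next
  case False
  define w where "w = bergman_functional \<alpha> k f"
  define c where "c = cnj w / of_real (cmod w * bergman_norm p \<alpha> f)"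
  have pos: "0 < bergman_norm p \<alpha> f" "0 < cmod w"
    using False bergman_norm_nonneg[of p f] by (auto simp: w_def)
  have "cmod c * bergman_norm p \<alpha> f = 1"
    using pos by (simp add: c_def norm_divide norm_mult)
  then have "bergman_norm p \<alpha> (\<lambda>z. c * f z) = 1"
    using p_gt_1 bergman_norm_cmult[of p c f] by simp
  moreover have "(\<lambda>z. c * f z) \<in> bergman_space p \<alpha>" by (rule bergman_space_cmult[OF f])
  ultimately have "Re (bergman_functional \<alpha> k (\<lambda>z. c * f z)) \<le> Re (bergman_functional \<alpha> k F)"
    using F unfolding extremal_function_def extremal_in_def by blast
  also have "bergman_functional \<alpha> k (\<lambda>z. c * f z) = of_real (cmod w / bergman_norm p \<alpha> f)"
  proof -
    have "c * w = of_real ((cmod w)\<^sup>2) / of_real (cmod w * bergman_norm p \<alpha> f)"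
      unfolding c_def complex_norm_square by simp
    also have "\<dots> = of_real (cmod w / bergman_norm p \<alpha> f)"
      using pos by (simp add: power2_eq_square)
    finally show ?thesis by (simp add: bergman_functional_cmult w_def)
  qed
  finally show ?thesis using pos by (simp add: w_def field_simps)
qed

text \<open>A function of norm 1 exists, so the measure is not zero; then some monomial is not
  annihilated, and its value is bounded by the extremal one.\<close>

lemma extremal_value_pos:
  assumes F: "extremal_function p \<alpha> k F" and k: "k \<in> bergman_space q \<alpha>" and nz: "\<exists>z\<in>ball 0 1. k z \<noteq> 0"
  shows "0 < Re (bergman_functional \<alpha> k F)"
proof -
  have "bergman_norm p \<alpha> F = 1" using F by (simp add: extremal_function_def extremal_in_def)
  then have "(LINT z|\<mu>. cmod (F z) powr p) = 1"
    using bergman_norm_powr[of p F] p_gt_1 by simp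
  moreover have "(LINT z|\<mu>. cmod (F z) powr p) = 0" if "AE z in \<mu>. False"
    by (rule integral_eq_zero_AE) (use that in \<open>auto elim: eventually_mono\<close>)
  ultimately have "\<not> (AE z in \<mu>. False)" by auto
  from functional_nontrivial[OF k nz this] obtain j where "bergman_functional \<alpha> k (\<lambda>z. z ^ j) \<noteq> 0" ..
  then have "0 < cmod (bergman_functional \<alpha> k (\<lambda>z. z ^ j))" by simp
  also have "\<dots> \<le> Re (bergman_functional \<alpha> k F) * bergman_norm p \<alpha> (\<lambda>z. z ^ j)"
    using p_gt_1 by (intro norm_functional_le_extremal[OF F k] bergman_space_power) auto
  finally show ?thesis
    using bergman_norm_nonneg[of p "\<lambda>z. z ^ j"] by (simp add: zero_less_mult_iff)
qed

text \<open>The supremum is attained at F, where the modulus of the value equals its real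
  part.\<close>

lemma functional_norm_eq_extremal_value:
  assumes F: "extremal_function p \<alpha> k F" and k: "k \<in> bergman_space q \<alpha>"
    and pos: "0 < Re (bergman_functional \<alpha> k F)"
  shows "bergman_functional_norm p \<alpha> k = Re (bergman_functional \<alpha> k F)"
  unfolding bergman_functional_norm_def
proof (rule cSup_eq_maximum)
  have F': "F \<in> bergman_space p \<alpha>" "bergman_norm p \<alpha> F = 1"
    using F by (auto simp: extremal_function_def extremal_in_def)
  have "cmod (bergman_functional \<alpha> k F) \<le> Re (bergman_functional \<alpha> k F)"
    using norm_functional_le_extremal[OF F k F'(1)] F'(2) by simp
  then have "Re (bergman_functional \<alpha> k F) = cmod (bergman_functional \<alpha> k F)"
    using complex_Re_le_cmod by (intro antisym) auto
  then show "Re (bergman_functional \<alpha> k F) \<in> (\<lambda>f. cmod (bergman_functional \<alpha> k f)) ` {f \<in> bergman_space p \<alpha>. bergman_norm p \<alpha> f \<le> 1}"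
    using F' by auto
next
  fix x assume "x \<in> (\<lambda>f. cmod (bergman_functional \<alpha> k f)) ` {f \<in> bergman_space p \<alpha>. bergman_norm p \<alpha> f \<le> 1}"
  then obtain f where f: "f \<in> bergman_space p \<alpha>" "bergman_norm p \<alpha> f \<le> 1" "x = cmod (bergman_functional \<alpha> k f)" by auto
  have "x \<le> Re (bergman_functional \<alpha> k F) * bergman_norm p \<alpha> f"
    using norm_functional_le_extremal[OF F k f(1)] f by simp
  also have "\<dots> \<le> Re (bergman_functional \<alpha> k F)"
    using pos f by (simp add: mult_left_le)
  finally show "x \<le> Re (bergman_functional \<alpha> k F)" .
qed

end

section \<open>Error of the extremal polynomials\<close>

lemma bergman_norm_cong_ball:
  "(\<And>z. z \<in> ball 0 1 \<Longrightarrow> f z = g z) \<Longrightarrow> bergman_norm p \<alpha> f = bergman_norm p \<alpha> g"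
  unfolding bergman_norm_def
  by (intro arg_cong[where f="\<lambda>x. x powr (1/p)"] Bochner_Integration.integral_cong) auto

lemma bergman_functional_cong_ball:
  "(\<And>z. z \<in> ball 0 1 \<Longrightarrow> f z = g z) \<Longrightarrow> bergman_functional \<alpha> k f = bergman_functional \<alpha> k g"
  unfolding bergman_functional_def
  by (intro Bochner_Integration.integral_cong) auto

text \<open>Jensen's inequality for the concave power beta/2 of the square, by the tangent bound at
  \<open>\<tau>\<^sup>2\<close>, where \<open>\<tau>\<close> bounds the root mean square. The last
  step weakens n + 2 to n.\<close>

lemma integral_abs_powr_fk_measure:
  assumes \<beta>: "0 < \<beta>" "\<beta> \<le> 2" and n: "1 \<le> n"
  shows "integrable (fk_measure n) (\<lambda>s. \<bar>s\<bar> powr \<beta>)"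
    and "(LINT s|fk_measure n. \<bar>s\<bar> powr \<beta>) \<le> (pi\<^sup>2 / 2) powr \<beta> * real n powr (- \<beta>)"
proof -
  interpret finite_measure "fk_measure n" by (rule finite_fk_measure)
  define \<tau> where "\<tau> = pi\<^sup>2 / (2 * real (n + 2))"
  have \<tau>: "0 < \<tau>" by (simp add: \<tau>_def)
  have "AE s in fk_measure n. norm (\<bar>s\<bar> powr \<beta>) \<le> pi powr \<beta>"
    using AE_fk_measure[of n] by eventually_elim (use \<beta> in \<open>auto intro: powr_mono2\<close>)
  then show i: "integrable (fk_measure n) (\<lambda>s. \<bar>s\<bar> powr \<beta>)"
    by (intro integrable_const_bound[of _ "pi powr \<beta>"]) auto
  have le: "\<bar>s\<bar> powr \<beta> \<le> \<tau> powr \<beta> * (\<beta> / 2 * (s\<^sup>2 / \<tau>\<^sup>2) + (1 - \<beta> / 2))" for s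
  proof -
    have "(s\<^sup>2 / \<tau>\<^sup>2) powr (\<beta> / 2) \<le> \<beta> / 2 * (s\<^sup>2 / \<tau>\<^sup>2) + (1 - \<beta> / 2)"
      using \<beta> by (intro powr_bernoulli_le) auto
    moreover have "(s\<^sup>2 / \<tau>\<^sup>2) powr (\<beta> / 2) = \<bar>s\<bar> powr \<beta> / \<tau> powr \<beta>"
    proof -
      have "s\<^sup>2 / \<tau>\<^sup>2 = (\<bar>s\<bar> / \<tau>)\<^sup>2" by (simp add: power_divide)
      then show ?thesis using \<tau> sq_powr_half[of "\<bar>s\<bar> / \<tau>" \<beta>] by (simp add: powr_divide)
    qed
    ultimately show ?thesis using \<tau> by (simp add: field_simps)
  qed
  have "(LINT s|fk_measure n. \<bar>s\<bar> powr \<beta>)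
      \<le> (LINT s|fk_measure n. \<tau> powr \<beta> * (\<beta> / 2 * (s\<^sup>2 / \<tau>\<^sup>2) + (1 - \<beta> / 2)))"
    using i le integrable_square_fk_measure by (intro integral_mono) auto
  also have "\<dots> = \<tau> powr \<beta> * (\<beta> / 2 * ((LINT s|fk_measure n. s\<^sup>2) / \<tau>\<^sup>2) + (1 - \<beta> / 2))"
    using integrable_square_fk_measure by (simp add: measure_fk_measure)
  also have "\<dots> \<le> \<tau> powr \<beta> * (\<beta> / 2 * 1 + (1 - \<beta> / 2))"
    using integral_square_fk_measure[of n, folded \<tau>_def] \<tau> \<beta>
    by (intro mult_left_mono add_mono) auto
  also have "\<dots> = \<tau> powr \<beta>" by simp
  also have "\<dots> \<le> (pi\<^sup>2 / 2 * (1 / real n)) powr \<beta>"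
    using n \<beta> by (intro powr_mono2) (auto simp: \<tau>_def field_simps)
  also have "\<dots> = (pi\<^sup>2 / 2) powr \<beta> * (1 / real n) powr \<beta>"
    by (subst powr_mult) auto
  also have "(1 / real n) powr \<beta> = real n powr (- \<beta>)"
    using n by (simp add: powr_divide powr_minus_divide)
  finally show "(LINT s|fk_measure n. \<bar>s\<bar> powr \<beta>) \<le> (pi\<^sup>2 / 2) powr \<beta> * real n powr (- \<beta>)" .
qed

context bergman_duality
begin

text \<open>Competitors have norm exactly 1, whereas averaging yields norm at most 1. A polynomial
  of positive value is scaled up to norm 1 without lowering its value; otherwise the negative of the
  extremal polynomial shows that the extremal value is nonnegative.\<close>

lemma extremal_polynomial_value_ge:
  assumes G: "extremal_polynomial p \<alpha> k n G" and k: "k \<in> bergman_space q \<alpha>"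
    and P: "degree P \<le> n" "bergman_norm p \<alpha> (poly P) \<le> 1"
  shows "Re (bergman_functional \<alpha> k (poly P)) \<le> Re (bergman_functional \<alpha> k G)"
proof -
  have max: "Re (bergman_functional \<alpha> k (poly Q)) \<le> Re (bergman_functional \<alpha> k G)"
    if "degree Q \<le> n" "bergman_norm p \<alpha> (poly Q) = 1" for Q
    using G that unfolding extremal_polynomial_def extremal_in_def by blast
  obtain R where R: "G = poly R" "degree R \<le> n" "bergman_norm p \<alpha> (poly R) = 1"
    using G unfolding extremal_polynomial_def extremal_in_def by blast
  have p0: "0 < p" using p_gt_1 by simp
  have scale: "bergman_norm p \<alpha> (poly (smult c Q)) = cmod c * bergman_norm p \<alpha> (poly Q)"
    "bergman_functional \<alpha> k (poly (smult c Q)) = c * bergman_functional \<alpha> k (poly Q)" for c Q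
    using bergman_norm_cmult[OF p0, of c "poly Q"] bergman_functional_cmult[of k c "poly Q"]
    by (simp_all add: poly_smult[abs_def])
  show ?thesis
  proof (cases "Re (bergman_functional \<alpha> k (poly P)) \<le> 0")
    case True
    have "Re (bergman_functional \<alpha> k (poly (smult (-1) R))) \<le> Re (bergman_functional \<alpha> k G)"
      using R by (intro max) (simp_all only: scale degree_smult_eq, auto)
    then have "0 \<le> Re (bergman_functional \<alpha> k G)" unfolding scale by (simp add: R)
    then show ?thesis using True by simp
  next
    case False
    define N where "N = bergman_norm p \<alpha> (poly P)"
    have "N \<noteq> 0"
      using False norm_functional_le[OF poly_in_bergman_space k, of P] p0 unfolding N_def[symmetric] by auto
    then have N: "0 < N" using bergman_norm_nonneg[of p "poly P"] by (simp add: N_def)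
    have "Re (bergman_functional \<alpha> k (poly P)) * 1 \<le> Re (bergman_functional \<alpha> k (poly P)) * (1 / N)"
      using False N P by (intro mult_left_mono) (auto simp: N_def field_simps)
    also have "\<dots> = Re (bergman_functional \<alpha> k (poly (smult (of_real (1 / N)) P)))"
      unfolding scale by simp
    also have "\<dots> \<le> Re (bergman_functional \<alpha> k G)"
      using P N by (intro max) (auto simp: scale N_def[symmetric] norm_divide intro: order_trans[OF degree_smult_le])
    finally show ?thesis by simp
  qed
qed

text \<open>The second-difference bound enters as the hypothesis \<open>S\<close> instead of the
  Zygmund condition, so that the case \<open>Z = 0\<close>, which arises for beta > 2, is covered
  too.\<close>

lemma extremal_polynomial_near_optimal:
  assumes F: "extremal_function p \<alpha> k F" and G: "extremal_polynomial p \<alpha> k n G"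
    and k: "k \<in> bergman_space q \<alpha>" and \<beta>: "0 < \<beta>" "\<beta> \<le> 2" and n: "1 \<le> n" and Z: "0 \<le> Z"
    and S: "\<And>s. 2 * Re (bergman_functional \<alpha> k F) - Z * \<bar>s\<bar> powr \<beta>
      \<le> Re (bergman_functional \<alpha> k (\<lambda>z. F (cis s * z))) + Re (bergman_functional \<alpha> k (\<lambda>z. F (cis (- s) * z)))"
  shows "Re (bergman_functional \<alpha> k F) - Z / 2 * ((pi\<^sup>2 / 2) powr \<beta> * real n powr (- \<beta>))
    \<le> Re (bergman_functional \<alpha> k G)"
proof -
  let ?N = "fk_measure n"
  interpret N: finite_measure ?N by (rule finite_fk_measure)
  define M where "M = Re (bergman_functional \<alpha> k F)"
  define g where "g s = Re (bergman_functional \<alpha> k (\<lambda>z. F (cis s * z)))" for s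
  have F': "F \<in> bergman_space p \<alpha>" "bergman_norm p \<alpha> F = 1"
    using F by (auto simp: extremal_function_def extremal_in_def)
  note avg = functional_average[OF finite_fk_measure sets_fk_measure, where w="\<lambda>_. 1" and W=1, OF _ _ F'(1) k, simplified]
  note iavg = integrable_functional_average[OF finite_fk_measure sets_fk_measure, where w="\<lambda>_. 1" and W=1, OF _ _ F'(1) k, simplified]
  have gi: "integrable ?N g" unfolding g_def by (rule integrable_Re[OF iavg])
  have gm [measurable]: "g \<in> borel_measurable borel"
    using borel_measurable_integrable[OF gi] by simp
  have gb: "\<bar>g s\<bar> \<le> M" for s
  proof -
    have "\<bar>g s\<bar> \<le> cmod (bergman_functional \<alpha> k (\<lambda>z. F (cis s * z)))"
      unfolding g_def by (rule abs_Re_le_cmod)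
    also have "\<dots> \<le> M * bergman_norm p \<alpha> (\<lambda>z. F (cis s * z))"
      unfolding M_def by (rule norm_functional_le_extremal[OF F k bergman_space_rotate[OF F'(1)]])
    finally show ?thesis using F'(2) bergman_norm_rotate[OF bergman_spaceD(3)[OF F'(1)], of p s] by simp
  qed
  have gi': "integrable ?N (\<lambda>s. g (- s))"
    by (rule N.integrable_const_bound[of _ M]) (auto simp: gb)
  obtain P where P: "degree P \<le> n" "\<And>z. z \<in> ball 0 1 \<Longrightarrow> (LINT s|?N. F (cis s * z)) = poly P z"
    using fk_average_is_polynomial[OF bergman_spaceD(1)[OF F'(1)]] by blast
  have "bergman_norm p \<alpha> (poly P) = bergman_norm p \<alpha> (\<lambda>z. LINT s|?N. F (cis s * z))"
    by (rule bergman_norm_cong_ball) (simp only: P(2))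
  also have "\<dots> \<le> 1"
    using bergman_norm_average_le[OF finite_fk_measure _ sets_fk_measure F'(1), of n] F'(2) measure_fk_measure by simp
  finally have norm: "bergman_norm p \<alpha> (poly P) \<le> 1" .
  have "bergman_functional \<alpha> k (poly P) = bergman_functional \<alpha> k (\<lambda>z. LINT s|?N. F (cis s * z))"
    by (rule bergman_functional_cong_ball) (simp only: P(2))
  also have "\<dots> = (LINT s|?N. bergman_functional \<alpha> k (\<lambda>z. F (cis s * z)))" by (rule avg)
  finally have "Re (bergman_functional \<alpha> k (poly P)) = (LINT s|?N. g s)"
    unfolding g_def using integral_Re[OF iavg] by simp
  \<comment> \<open>Evenness of the kernel produces the symmetric sum that \<open>S\<close> bounds
    from below.\<close>
  also have "\<dots> = (LINT s|?N. g s + g (- s)) / 2"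
    using gi gi' integral_uminus_fk_measure[OF gm, of n] by simp
  also have "\<dots> \<ge> (LINT s|?N. 2 * M - Z * \<bar>s\<bar> powr \<beta>) / 2"
    using gi gi' integral_abs_powr_fk_measure(1)[OF \<beta> n] S[folded M_def g_def]
    by (intro divide_right_mono integral_mono) auto
  finally have "(LINT s|?N. 2 * M - Z * \<bar>s\<bar> powr \<beta>) / 2 \<le> Re (bergman_functional \<alpha> k (poly P))" .
  moreover have "(LINT s|?N. 2 * M - Z * \<bar>s\<bar> powr \<beta>) = 2 * M - Z * (LINT s|?N. \<bar>s\<bar> powr \<beta>)"
    using integral_abs_powr_fk_measure(1)[OF \<beta> n] by (simp add: measure_fk_measure)
  moreover have "Z * (LINT s|?N. \<bar>s\<bar> powr \<beta>) \<le> Z * ((pi\<^sup>2 / 2) powr \<beta> * real n powr (- \<beta>))"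
    by (intro mult_left_mono integral_abs_powr_fk_measure \<beta> n Z)
  ultimately have "M - Z / 2 * ((pi\<^sup>2 / 2) powr \<beta> * real n powr (- \<beta>)) \<le> Re (bergman_functional \<alpha> k (poly P))"
    by simp
  also have "\<dots> \<le> Re (bergman_functional \<alpha> k G)"
    by (rule extremal_polynomial_value_ge[OF G k P(1) norm])
  finally show ?thesis by (simp add: M_def)
qed

text \<open>The midpoint \<open>h\<close> of F and G has value at least M (1 - delta/2), while M
  times its norm bounds that value. So its norm is at least 1 - delta/2, Bernoulli bounds the defect
  of its p-th power by p delta/2, and uniform convexity converts this defect into a
  distance.\<close>

lemma
  assumes F: "extremal_function p \<alpha> k F" and k: "k \<in> bergman_space q \<alpha>"
    and M: "0 < Re (bergman_functional \<alpha> k F)"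
    and G: "G \<in> bergman_space p \<alpha>" "bergman_norm p \<alpha> G = 1"
    and near: "Re (bergman_functional \<alpha> k F) * (1 - \<delta>) \<le> Re (bergman_functional \<alpha> k G)"
  shows distance_le_2: "bergman_norm p \<alpha> (\<lambda>z. F z - G z) \<le> 2"
    and distance_gt_2: "2 < p \<Longrightarrow> (bergman_norm p \<alpha> (\<lambda>z. F z - G z) / 2) powr p \<le> p * \<delta> / 2"
    and distance_lt_2: "p < 2 \<Longrightarrow> (p - 1)\<^sup>2 * (bergman_norm p \<alpha> (\<lambda>z. F z - G z))\<^sup>2 \<le> 4 * \<delta>"
proof -
  define M where "M = Re (bergman_functional \<alpha> k F)"
  define D where "D = bergman_norm p \<alpha> (\<lambda>z. F z - G z)"
  have p0: "0 < p" "p \<noteq> 0" using p_gt_1 by auto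
  have F': "F \<in> bergman_space p \<alpha>" "bergman_norm p \<alpha> F = 1"
    using F by (auto simp: extremal_function_def extremal_in_def)
  have F1: "(LINT z|\<mu>. cmod (F z) powr p) = 1" and G1: "(LINT z|\<mu>. cmod (G z) powr p) = 1"
    using bergman_norm_powr[of p F] bergman_norm_powr[of p G] F' G p0 by auto
  note fm = bergman_spaceD(3)[OF F'(1)] and gm = bergman_spaceD(3)[OF G(1)]
  note fi = bergman_spaceD(2)[OF F'(1)] and gi = bergman_spaceD(2)[OF G(1)]
  have Dp: "D powr p = (LINT z|\<mu>. cmod (F z - G z) powr p)"
    unfolding D_def by (rule bergman_norm_powr[OF p0(1)])
  have D0: "0 \<le> D" by (simp add: D_def bergman_norm_nonneg)
  have "D powr p \<le> 2 powr p"
    unfolding Dp by (rule LINT_diff_powr_le[OF p_gt_1 fm gm fi gi F1 G1])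
  then show "D \<le> 2" using p0 D0 powr_less_mono2[of p 2 D] by (auto simp: not_le[symmetric])
  define h where "h = (\<lambda>z. (1/2) * (F z + G z))"
  have h: "h \<in> bergman_space p \<alpha>"
    unfolding h_def by (intro bergman_space_cmult bergman_space_add F' G p_gt_1)
  have "bergman_functional \<alpha> k h = (1/2) * (bergman_functional \<alpha> k F + bergman_functional \<alpha> k G)"
    unfolding h_def bergman_functional_cmult bergman_functional_add[OF F'(1) G(1) k] ..
  then have "M * (1 - \<delta> / 2) \<le> Re (bergman_functional \<alpha> k h)"
    using near by (simp add: M_def algebra_simps)
  also have "\<dots> \<le> cmod (bergman_functional \<alpha> k h)" by (rule complex_Re_le_cmod)
  also have "\<dots> \<le> M * bergman_norm p \<alpha> h"
    unfolding M_def by (rule norm_functional_le_extremal[OF F k h])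
  finally have hn: "1 - \<delta> / 2 \<le> bergman_norm p \<alpha> h" using M by (simp add: M_def)
  define H where "H = (LINT z|\<mu>. cmod ((F z + G z) / 2) powr p)"
  have "H = bergman_norm p \<alpha> h powr p"
    unfolding H_def by (simp add: bergman_norm_powr[OF p0(1)] h_def)
  moreover have "1 + p * (bergman_norm p \<alpha> h - 1) \<le> bergman_norm p \<alpha> h powr p"
    by (rule powr_bernoulli[OF p_gt_1 bergman_norm_nonneg])
  moreover have "p * (1 - \<delta> / 2) \<le> p * bergman_norm p \<alpha> h"
    using hn p0 by (intro mult_left_mono) auto
  ultimately have H: "1 - H \<le> p * \<delta> / 2" by (simp add: algebra_simps)
  show "(D / 2) powr p \<le> p * \<delta> / 2" if p2: "2 < p"
  proof -
    have "(D / 2) powr p = (LINT z|\<mu>. cmod ((F z - G z) / 2) powr p)"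
      using Dp D0 by (simp add: powr_divide norm_divide)
    also have "\<dots> \<le> 1 - H"
      using clarkson_Lp[OF p2 fm gm fi gi] by (simp add: F1 G1 H_def)
    finally show ?thesis using H by simp
  qed
  show "(p - 1)\<^sup>2 * D\<^sup>2 \<le> 4 * \<delta>" if p2: "p < 2"
  proof -
    have D2: "(LINT z|\<mu>. cmod (F z - G z) powr p) powr (2 / p) = D\<^sup>2"
      unfolding Dp[symmetric] using p0 D0 by (simp add: powr_powr)
    have "p * (p - 1) * D\<^sup>2 \<le> 8 * 2 powr (2 / p - 1) * (1 - H)"
      using uniform_convexity_Lp[OF p_gt_1 p2 fm gm fi gi F1 G1] unfolding D2 H_def .
    also have "\<dots> \<le> 8 * 2 powr (2 / p - 1) * (p * \<delta> / 2)"
      by (intro mult_left_mono H) auto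
    finally have "p * ((p - 1) * D\<^sup>2) \<le> p * (4 * 2 powr (2 / p - 1) * \<delta>)"
      by (simp add: algebra_simps)
    then have A: "(p - 1) * D\<^sup>2 \<le> 4 * 2 powr (2 / p - 1) * \<delta>"
      using p0 by (simp only: mult_le_cancel_left_pos)
    have "0 \<le> (p - 1) * D\<^sup>2" using p_gt_1 by simp
    then have \<delta>: "0 \<le> \<delta>" using A by (smt (verit) powr_gt_zero mult_pos_neg)
    \<comment> \<open>The exponent lies between 0 and 1, so the concave Bernoulli bound gives 2/p;
      together with p < 2 this absorbs one factor p - 1.\<close>
    have "2 powr (2 / p - 1) \<le> (2 / p - 1) * 2 + (1 - (2 / p - 1))"
      using p2 p_gt_1 by (intro powr_bernoulli_le) (auto simp: field_simps)
    also have "\<dots> = 2 / p" by simp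
    finally have "(p - 1) * 2 powr (2 / p - 1) \<le> (p - 1) * (2 / p)"
      using p_gt_1 by (intro mult_left_mono) auto
    also have "\<dots> \<le> 1" using p2 p_gt_1 by (simp add: field_simps)
    finally have B: "(p - 1) * 2 powr (2 / p - 1) \<le> 1" .
    have "(p - 1)\<^sup>2 * D\<^sup>2 = (p - 1) * ((p - 1) * D\<^sup>2)" by (simp add: power2_eq_square)
    also have "\<dots> \<le> (p - 1) * (4 * 2 powr (2 / p - 1) * \<delta>)"
      using A p_gt_1 by (intro mult_left_mono) auto
    also have "\<dots> = ((p - 1) * 2 powr (2 / p - 1)) * (4 * \<delta>)" by simp
    also have "\<dots> \<le> 1 * (4 * \<delta>)" using B \<delta> by (intro mult_right_mono) auto
    finally show ?thesis by simp
  qed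
qed

end

text \<open>For each nonzero t the condition bounds C from below by a fixed quotient, so it passes
  to the infimum; at t = 0 the second difference is 0. The choice t = 1 shows that all constants are
  nonnegative.\<close>

lemma zygmund_bound_Inf:
  assumes "zygmund_bound \<beta> q \<alpha> k C"
  shows "zygmund_bound \<beta> q \<alpha> k (zygmund_norm \<beta> q \<alpha> k)" "0 \<le> zygmund_norm \<beta> q \<alpha> k"
proof -
  have nn: "0 \<le> D" if "zygmund_bound \<beta> q \<alpha> k D" for D
  proof -
    have "0 \<le> bergman_norm q \<alpha> (\<lambda>z. k (cis 1 * z) + k (cis (- 1) * z) - 2 * k z)"
      by (simp add: bergman_norm_def)
    also have "\<dots> \<le> D * \<bar>1\<bar> powr \<beta>" using that unfolding zygmund_bound_def by blast
    finally show ?thesis by simp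
  qed
  show "0 \<le> zygmund_norm \<beta> q \<alpha> k"
    unfolding zygmund_norm_def using assms nn by (intro cInf_greatest) auto
  show "zygmund_bound \<beta> q \<alpha> k (zygmund_norm \<beta> q \<alpha> k)"
    unfolding zygmund_bound_def
  proof
    fix t :: real
    define N where "N = bergman_norm q \<alpha> (\<lambda>z. k (cis t * z) + k (cis (- t) * z) - 2 * k z)"
    show "N \<le> zygmund_norm \<beta> q \<alpha> k * \<bar>t\<bar> powr \<beta>"
    proof (cases "t = 0")
      case True
      then show ?thesis by (simp add: N_def bergman_norm_def)
    next
      case False
      have "N / \<bar>t\<bar> powr \<beta> \<le> D" if "zygmund_bound \<beta> q \<alpha> k D" for D
        using that False unfolding zygmund_bound_def N_def by (simp add: field_simps)
      then have "N / \<bar>t\<bar> powr \<beta> \<le> zygmund_norm \<beta> q \<alpha> k"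
        unfolding zygmund_norm_def using assms by (intro cInf_greatest) auto
      then show ?thesis using False by (simp add: field_simps)
    qed
  qed
qed

text \<open>
  The Bochner integral of a non-integrable function is 0, so a constant of norm 1 can only exist if
  the measure is finite.  This replaces the computation of the total mass.
\<close>

lemma finite_bergman_measure_if_extremal_polynomial:
  assumes "extremal_polynomial p \<alpha> k 0 G" and p: "0 < p"
  shows "finite_measure (bergman_measure \<alpha>)"
proof (rule finite_measureI)
  obtain P where P: "G = poly P" "degree P = 0" "bergman_norm p \<alpha> G = 1"
    using assms unfolding extremal_polynomial_def extremal_in_def by auto
  obtain c where c: "P = [:c:]" using P(2) by (rule degree_eq_zeroE)
  have one: "(LINT z|bergman_measure \<alpha>. cmod c powr p) powr (1 / p) = 1"
    using P(3) by (simp add: P(1) c bergman_norm_def)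
  then have c0: "c \<noteq> 0" by auto
  have "integrable (bergman_measure \<alpha>) (\<lambda>z. cmod c powr p)"
  proof (rule ccontr)
    assume "\<not> ?thesis"
    then have "(LINT z|bergman_measure \<alpha>. cmod c powr p) = 0" by (rule not_integrable_integral_eq)
    then show False using one by (simp only: powr_0 zero_neq_one)
  qed
  then show "emeasure (bergman_measure \<alpha>) (space (bergman_measure \<alpha>)) \<noteq> \<infinity>"
    using c0 by (auto simp: integrable_iff_bounded nn_integral_const ennreal_mult_eq_top_iff less_top ennreal_mult_less_top)
qed

text \<open>\<open>N \<le> 2\<close> gives N^4 <= 4 N^2, hence N^4 <= 16 (p - 1)^(-2) delta. The
  fourth power of the right side is 256 (p - 1)^(-3) c^2 K r^(-beta), and \<open>c\<close> supplies
  the missing (pi^2/2)^beta <= 32 c^2. It is stated for any \<open>c\<close>, to serve both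
  \<open>A_const\<close> and \<open>B_tilde_0\<close>.\<close>

lemma rate_lt_2:
  fixes N K c p \<beta> \<delta> r :: real
  assumes p: "1 < p" "p < 2" and N: "0 \<le> N" "N \<le> 2"
    and dist: "(p - 1)\<^sup>2 * N\<^sup>2 \<le> 4 * \<delta>" and \<delta>: "\<delta> = K / 2 * ((pi\<^sup>2 / 2) powr \<beta> * r powr (- \<beta>))"
    and c: "(pi\<^sup>2 / 2) powr (\<beta> / 2) \<le> 4 * sqrt 2 * c" and K: "0 \<le> K" and r: "0 < r"
  shows "N \<le> 4 * (p - 1) powr (- 3 / 4) * c powr (1 / 2) * K powr (1 / 4) * r powr (- \<beta> / 4)"
proof -
  define R where "R = 4 * (p - 1) powr (- 3 / 4) * c powr (1 / 2) * K powr (1 / 4) * r powr (- \<beta> / 4)"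
  have c0: "0 < c"
  proof -
    have "0 < (pi\<^sup>2 / 2) powr (\<beta> / 2)" by simp
    then have "0 < 4 * sqrt 2 * c" using c by linarith
    then show ?thesis by (simp add: zero_less_mult_iff)
  qed
  have pw: "(x powr a) ^ 4 = x powr (a * 4)" if "0 \<le> x" for x a :: real
    using that by (cases "x = 0") (auto simp: powr_power mult.commute)
  have R4: "R ^ 4 = 256 * (p - 1) powr (- 3) * c\<^sup>2 * K * r powr (- \<beta>)"
    using p c0 K r unfolding R_def power_mult_distrib by (simp add: pw)
  have "(pi\<^sup>2 / 2) powr \<beta> = ((pi\<^sup>2 / 2) powr (\<beta> / 2))\<^sup>2"
    by (simp add: powr_power)
  also have "\<dots> \<le> (4 * sqrt 2 * c)\<^sup>2" using c by (intro power_mono) auto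
  also have "\<dots> = 32 * c\<^sup>2" by (simp add: power_mult_distrib)
  finally have cb: "(pi\<^sup>2 / 2) powr \<beta> \<le> 32 * c\<^sup>2" .
  have "N ^ 4 \<le> 4 * N\<^sup>2"
  proof -
    have "N\<^sup>2 \<le> 2\<^sup>2" using N by (intro power_mono) auto
    then have "N\<^sup>2 * N\<^sup>2 \<le> 4 * N\<^sup>2" by (intro mult_right_mono) auto
    then show ?thesis by (simp add: power4_eq_xxxx power2_eq_square mult_ac)
  qed
  moreover have "(p - 1) powr (- 2) * ((p - 1)\<^sup>2 * N\<^sup>2) \<le> (p - 1) powr (- 2) * (4 * \<delta>)"
    using dist by (intro mult_left_mono) auto
  moreover have "(p - 1) powr (- 2) * (p - 1)\<^sup>2 = 1"
    using p powr_add[of "p - 1" "- 2" 2] by simp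
  ultimately have "N ^ 4 \<le> 16 * (p - 1) powr (- 2) * \<delta>"
    by (simp add: mult.assoc[symmetric])
  also have "\<dots> = 8 * (p - 1) powr (- 2) * (K * r powr (- \<beta>)) * (pi\<^sup>2 / 2) powr \<beta>"
    by (simp add: \<delta>)
  also have "\<dots> \<le> 8 * (p - 1) powr (- 3) * (K * r powr (- \<beta>)) * (32 * c\<^sup>2)"
  proof -
    have "(p - 1) powr (- 2) \<le> (p - 1) powr (- 3)" using p by (intro powr_mono') auto
    then show ?thesis using K cb by (intro mult_mono) auto
  qed
  also have "\<dots> = R ^ 4" by (simp add: R4)
  finally have "N ^ 4 \<le> R ^ 4" .
  moreover have "0 \<le> R" using c0 by (simp add: R_def)
  ultimately have "N \<le> R" by (rule power_le_imp_le_base[of _ 3, simplified])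
  then show ?thesis by (simp add: R_def)
qed

text \<open>Both sides are compared after raising to the power p^2: N/2 is at most 1, so its power
  p^2 is at most its power p, which \<open>dist\<close> controls.\<close>

lemma rate_gt_2:
  fixes N K c p \<beta> \<delta> r :: real
  assumes p: "2 < p" and N: "0 \<le> N" "N \<le> 2"
    and dist: "(N / 2) powr p \<le> p * \<delta> / 2" and \<delta>: "\<delta> = K / 2 * ((pi\<^sup>2 / 2) powr \<beta> * r powr (- \<beta>))"
    and c: "(pi\<^sup>2 / 2) powr (\<beta> / p) \<le> 4 * sqrt 2 * c" and K: "0 \<le> K" and r: "0 < r"
  shows "N \<le> 2 powr (1 + 1 / p - 1 / p\<^sup>2) * p powr (1 / p + 1 / p\<^sup>2) * c powr (1 / p) * K powr (1 / p\<^sup>2) * r powr (- \<beta> / p\<^sup>2)"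
proof -
  define R where "R = 2 powr (1 + 1 / p - 1 / p\<^sup>2) * p powr (1 / p + 1 / p\<^sup>2) * c powr (1 / p) * K powr (1 / p\<^sup>2) * r powr (- \<beta> / p\<^sup>2)"
  have c0: "0 < c"
  proof -
    have "0 < (pi\<^sup>2 / 2) powr (\<beta> / p)" by simp
    then have "0 < 4 * sqrt 2 * c" using c by linarith
    then show ?thesis by (simp add: zero_less_mult_iff)
  qed
  have e: "(1 + 1 / p - 1 / p\<^sup>2) * p\<^sup>2 = p\<^sup>2 + p - 1" "(1 / p + 1 / p\<^sup>2) * p\<^sup>2 = p + 1"
    "1 / p * p\<^sup>2 = p" "1 / p\<^sup>2 * p\<^sup>2 = 1" "- \<beta> / p\<^sup>2 * p\<^sup>2 = - \<beta>" "p\<^sup>2 / p = p"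
    using p by (simp_all add: field_simps power2_eq_square)
  have Rp: "R powr p\<^sup>2 = 2 powr (p\<^sup>2 + p - 1) * p powr (p + 1) * c powr p * K * r powr (- \<beta>)"
    using K c0 p r unfolding R_def by (simp add: powr_mult powr_powr e)
  \<comment> \<open>The p-th power of 4 sqrt 2 is
    \<open>2 powr (p * 2 + 1) * 2 powr (p / 2 - 1)\<close>; the last factor must be absorbed into a
    power of p to reach the stated constant. Taking logarithms, (p/2 - 1) ln 2 <= p - 2 <= p ln
    (p/2).\<close>
  have half: "2 powr (p / 2 - 1) \<le> (p / 2) powr p"
  proof -
    have ln1: "1 - 2 / p \<le> ln (p / 2)"
      using ln_le_minus_one[of "2 / p"] p by (simp add: ln_div)
    have "(p / 2 - 1) * ln 2 \<le> (p / 2 - 1) * 1"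
      using p ln_2_less_1 by (intro mult_left_mono) auto
    also have "\<dots> \<le> p * (1 - 2 / p)" using p by (simp add: field_simps)
    also have "\<dots> \<le> p * ln (p / 2)" using ln1 p by (intro mult_left_mono) auto
    finally show ?thesis using p by (simp add: powr_def)
  qed
  have "(pi\<^sup>2 / 2) powr \<beta> = ((pi\<^sup>2 / 2) powr (\<beta> / p)) powr p"
    using p by (simp add: powr_powr)
  also have "\<dots> \<le> (4 * sqrt 2 * c) powr p" using c p by (intro powr_mono2) auto
  also have "\<dots> = 2 powr (p * 2 + p / 2) * c powr p"
  proof -
    have "4 * sqrt 2 = 2 powr (2 + 1/2)" by (subst powr_add) (simp add: powr_half_sqrt)
    then have "(4 * sqrt 2 * c) powr p = (2 powr (2 + 1/2)) powr p * c powr p"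
      using c0 by (simp add: powr_mult)
    also have "(2 powr (2 + 1/2)) powr p = 2 powr (p * 2 + p / 2)"
      unfolding powr_powr by (simp add: algebra_simps)
    finally show ?thesis .
  qed
  also have "2 powr (p * 2 + p / 2) = 2 powr (p * 2 + 1) * 2 powr (p / 2 - 1)"
    by (subst powr_add[symmetric]) (simp add: algebra_simps)
  also have "\<dots> * c powr p \<le> 2 powr (p * 2 + 1) * (p / 2) powr p * c powr p"
    using half by (intro mult_right_mono mult_left_mono) auto
  also have "2 powr (p * 2 + 1) * (p / 2) powr p = 2 powr (p + 1) * p powr p"
  proof -
    have "2 powr (p * 2 + 1) = 2 powr (p + 1) * 2 powr p"
      by (subst powr_add[symmetric]) (simp add: algebra_simps)
    then show ?thesis using p by (simp add: powr_divide)
  qed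
  finally have cb: "(pi\<^sup>2 / 2) powr \<beta> \<le> 2 powr (p + 1) * p powr p * c powr p" .
  have "(N / 2) powr p\<^sup>2 \<le> (N / 2) powr p"
    using N p by (intro powr_mono') (auto simp: power2_eq_square)
  also have "\<dots> \<le> p / 4 * (K * r powr (- \<beta>)) * (pi\<^sup>2 / 2) powr \<beta>"
    using dist by (simp add: \<delta> mult_ac)
  also have "\<dots> \<le> p / 4 * (K * r powr (- \<beta>)) * (2 powr (p + 1) * p powr p * c powr p)"
    using p K cb by (intro mult_left_mono) auto
  also have "\<dots> = 2 powr (p - 1) * p powr (p + 1) * c powr p * K * r powr (- \<beta>)"
  proof -
    have "2 powr (p + 1) / 4 = 2 powr (p - 1)"
      using powr_diff[of 2 "p + 1" 2] by simp
    moreover have "p * p powr p = p powr (p + 1)" using p by (simp add: powr_add)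
    ultimately show ?thesis by (simp add: field_simps)
  qed
  finally have "2 powr p\<^sup>2 * (N / 2) powr p\<^sup>2 \<le> 2 powr p\<^sup>2 * (2 powr (p - 1) * p powr (p + 1) * c powr p * K * r powr (- \<beta>))"
    by (intro mult_left_mono) auto
  moreover have "2 powr p\<^sup>2 * (N / 2) powr p\<^sup>2 = N powr p\<^sup>2"
    using N by (simp add: powr_divide)
  moreover have "2 powr p\<^sup>2 * 2 powr (p - 1) = 2 powr (p\<^sup>2 + p - 1)"
    by (subst powr_add[symmetric]) (simp only: add_diff_eq)
  ultimately have "N powr p\<^sup>2 \<le> R powr p\<^sup>2"
    unfolding Rp by (simp add: mult.assoc[symmetric])
  moreover have "0 \<le> R" by (simp add: R_def)
  ultimately have "N \<le> R"
    using powr_less_mono2[of "p\<^sup>2" R N] p by (auto simp: not_le[symmetric])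
  then show ?thesis by (simp add: R_def)
qed

theorem theorem3p2:
  fixes p q \<alpha> \<beta> :: real
    and k F :: "complex \<Rightarrow> complex"
    and Fn :: "nat \<Rightarrow> complex \<Rightarrow> complex"
  assumes "1 < p" and "p \<noteq> 2" and "1 / p + 1 / q = 1" and "-1 < \<alpha>"
    and "k \<in> zygmund_class \<beta> q \<alpha>"
    and "\<exists>z\<in>ball 0 1. k z \<noteq> 0"
    and "extremal_function p \<alpha> k F"
    and "\<And>n. extremal_polynomial p \<alpha> k n (Fn n)"
  shows
    "(p < 2 \<longrightarrow>
        (\<lambda>n. bergman_norm p \<alpha> (\<lambda>z. F z - Fn n z)) \<in> O(\<lambda>n. real n powr (- \<beta> / 4))) \<and>
     (p > 2 \<longrightarrow>
        (\<lambda>n. bergman_norm p \<alpha> (\<lambda>z. F z - Fn n z)) \<in> O(\<lambda>n. real n powr (- \<beta> / p\<^sup>2))) \<and>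
     (p < 2 \<and> 0 < \<beta> \<and> \<beta> < 2 \<longrightarrow>
        (\<forall>n\<ge>1. bergman_norm p \<alpha> (\<lambda>z. F z - Fn n z)
           \<le> 4 * (p - 1) powr (- 3 / 4) * A_const (\<beta> / 2) powr (1 / 2)
              * normalized_zygmund_norm \<beta> p q \<alpha> k powr (1 / 4) * real n powr (- \<beta> / 4))) \<and>
     (p < 2 \<and> \<beta> = 2 \<longrightarrow>
        (\<forall>n\<ge>1. bergman_norm p \<alpha> (\<lambda>z. F z - Fn n z)
           \<le> 4 * (p - 1) powr (- 3 / 4) * B_tilde_0 powr (1 / 2)
              * normalized_zygmund_norm \<beta> p q \<alpha> k powr (1 / 4) * real n powr (- \<beta> / 4))) \<and>
     (p > 2 \<and> 0 < \<beta> \<and> \<beta> \<le> 2 \<longrightarrow>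
        (\<forall>n\<ge>1. bergman_norm p \<alpha> (\<lambda>z. F z - Fn n z)
           \<le> 2 powr (1 + 1 / p - 1 / p\<^sup>2) * p powr (1 / p + 1 / p\<^sup>2) * A_const (\<beta> / p) powr (1 / p)
              * normalized_zygmund_norm \<beta> p q \<alpha> k powr (1 / p\<^sup>2) * real n powr (- \<beta> / p\<^sup>2)))"
proof -
  note F = assms(7) and Fn = assms(8)
  have p1: "1 < p" by fact
  have q1: "1 < q"
  proof -
    have "0 < 1 / p" "1 / p < 1" using p1 by simp_all
    then have *: "0 < 1 / q" "1 / q < 1" using assms(3) by linarith+
    then have "0 < q" by simp
    then show ?thesis using * by (simp add: pos_divide_less_eq)
  qed
  have fin: "finite_measure (bergman_measure \<alpha>)"
    using p1 by (intro finite_bergman_measure_if_extremal_polynomial[OF Fn[of 0]]) simp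
  interpret bergman_duality p q \<alpha>
    by (rule bergman_duality.intro[OF p1 q1 assms(3) fin])
  obtain C where C: "zygmund_bound \<beta> q \<alpha> k C" and k: "k \<in> bergman_space q \<alpha>"
    using assms(5) by (auto simp: zygmund_class_def)
  define Z where "Z = zygmund_norm \<beta> q \<alpha> k"
  have Z: "zygmund_bound \<beta> q \<alpha> k Z" "0 \<le> Z"
    unfolding Z_def by (rule zygmund_bound_Inf[OF C])+
  define M where "M = Re (bergman_functional \<alpha> k F)"
  have M: "0 < M" unfolding M_def by (rule extremal_value_pos[OF F k assms(6)])
  have nz: "normalized_zygmund_norm \<beta> p q \<alpha> k = Z / M"
    using functional_norm_eq_extremal_value[OF F k] M
    by (simp add: normalized_zygmund_norm_def Z_def M_def)
  have F': "F \<in> bergman_space p \<alpha>" "bergman_norm p \<alpha> F = 1"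
    using F by (auto simp: extremal_function_def extremal_in_def)
  have G: "Fn n \<in> bergman_space p \<alpha>" "bergman_norm p \<alpha> (Fn n) = 1" for n
    using Fn[of n] poly_in_bergman_space[of p] p1 unfolding extremal_polynomial_def extremal_in_def by auto
  define N where "N n = bergman_norm p \<alpha> (\<lambda>z. F z - Fn n z)" for n
  have N0: "0 \<le> N n" for n by (simp add: N_def bergman_norm_nonneg)
  have N2: "N n \<le> 2" for n
  proof -
    \<comment> \<open>With delta taken as the exact relative defect, the near-optimality hypothesis
      is an identity.\<close>
    have "M * (1 - (1 - Re (bergman_functional \<alpha> k (Fn n)) / M)) \<le> Re (bergman_functional \<alpha> k (Fn n))"
      using M by simp
    then show ?thesis unfolding N_def using M unfolding M_def by (intro distance_le_2[OF F k _ G])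
  qed
  \<comment> \<open>Dividing the defect by \<open>M\<close> gives the delta of the distance
    estimates; for \<open>D = Z\<close> its factor \<open>Z / M\<close> is the normalised Zygmund
    norm.\<close>
  have near: "M * (1 - D / M / 2 * ((pi\<^sup>2 / 2) powr b * real n powr (- b))) \<le> Re (bergman_functional \<alpha> k (Fn n))"
    if "\<And>s. 2 * M - D * \<bar>s\<bar> powr b
      \<le> Re (bergman_functional \<alpha> k (\<lambda>z. F (cis s * z))) + Re (bergman_functional \<alpha> k (\<lambda>z. F (cis (- s) * z)))"
      and "0 < b" "b \<le> 2" "1 \<le> n" "0 \<le> D" for D b n
    using extremal_polynomial_near_optimal[OF F Fn k that(2-5) that(1)[unfolded M_def]] M
    by (simp add: M_def[symmetric] algebra_simps)
  have second: "2 * M - Z * \<bar>s\<bar> powr \<beta>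
      \<le> Re (bergman_functional \<alpha> k (\<lambda>z. F (cis s * z))) + Re (bergman_functional \<alpha> k (\<lambda>z. F (cis (- s) * z)))" for s
    using order_trans[OF abs_Re_le_cmod functional_second_difference[OF F'(1) k Z(1), of s]] F'(2)
    by (simp add: M_def)
  have lt: "N n \<le> 4 * (p - 1) powr (- 3 / 4) * c powr (1 / 2) * (Z / M) powr (1 / 4) * real n powr (- \<beta> / 4)"
    if "p < 2" "0 < \<beta>" "\<beta> \<le> 2" "1 \<le> n" "(pi\<^sup>2 / 2) powr (\<beta> / 2) \<le> 4 * sqrt 2 * c" for n c
  proof (rule rate_lt_2[OF p1 that(1) N0 N2 _ refl that(5)])
    show "(p - 1)\<^sup>2 * (N n)\<^sup>2 \<le> 4 * (Z / M / 2 * ((pi\<^sup>2 / 2) powr \<beta> * real n powr (- \<beta>)))"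
      unfolding N_def
      by (rule distance_lt_2[OF F k M[unfolded M_def] G near[OF second that(2-4) Z(2), unfolded M_def] that(1), folded M_def])
  qed (use that M Z in auto)
  have gt: "N n \<le> 2 powr (1 + 1 / p - 1 / p\<^sup>2) * p powr (1 / p + 1 / p\<^sup>2) * c powr (1 / p) * (Z / M) powr (1 / p\<^sup>2) * real n powr (- \<beta> / p\<^sup>2)"
    if "2 < p" "0 < \<beta>" "\<beta> \<le> 2" "1 \<le> n" "(pi\<^sup>2 / 2) powr (\<beta> / p) \<le> 4 * sqrt 2 * c" for n c
  proof (rule rate_gt_2[OF that(1) N0 N2 _ refl that(5)])
    show "(N n / 2) powr p \<le> p * (Z / M / 2 * ((pi\<^sup>2 / 2) powr \<beta> * real n powr (- \<beta>))) / 2"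
      unfolding N_def
      by (rule distance_gt_2[OF F k M[unfolded M_def] G near[OF second that(2-4) Z(2), unfolded M_def] that(1), folded M_def])
  qed (use that M Z in auto)
  \<comment> \<open>The bound for \<open>A_const\<close> requires its argument to be below 1, so
    beta = 2 is handled separately through \<open>B_tilde_0\<close>; for p > 2 the argument beta/p
    stays below 1 even at beta = 2.\<close>
  have i: "N n \<le> 4 * (p - 1) powr (- 3 / 4) * A_const (\<beta> / 2) powr (1 / 2) * (Z / M) powr (1 / 4) * real n powr (- \<beta> / 4)"
    if "p < 2" "0 < \<beta>" "\<beta> < 2" "1 \<le> n" for n
    using that by (intro lt A_const_lower_bound) auto
  have ii: "N n \<le> 4 * (p - 1) powr (- 3 / 4) * B_tilde_0 powr (1 / 2) * (Z / M) powr (1 / 4) * real n powr (- \<beta> / 4)"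
    if "p < 2" "\<beta> = 2" "1 \<le> n" for n
    using that B_tilde_0_lower_bound by (intro lt) auto
  have iii: "N n \<le> 2 powr (1 + 1 / p - 1 / p\<^sup>2) * p powr (1 / p + 1 / p\<^sup>2) * A_const (\<beta> / p) powr (1 / p) * (Z / M) powr (1 / p\<^sup>2) * real n powr (- \<beta> / p\<^sup>2)"
    if "2 < p" "0 < \<beta>" "\<beta> \<le> 2" "1 \<le> n" for n
    using that by (intro gt A_const_lower_bound) auto
  have rigid: "N n = 0" if \<beta>: "2 < \<beta>" and n: "1 \<le> n" for n
  proof -
    define \<psi> where "\<psi> u = bergman_functional \<alpha> k (\<lambda>z. F (cis u * z))" for u
    \<comment> \<open>F rotated by \<open>u\<close> again has norm 1, so the second-difference bound
      holds at every base point \<open>u\<close>, as the halving argument requires.\<close>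
    have "cmod (\<psi> (u + s) + \<psi> (u - s) - 2 * \<psi> u) \<le> Z * \<bar>s\<bar> powr \<beta>" for u s
    proof -
      have "F (cis u * (cis s * z)) = F (cis (u + s) * z)" "F (cis u * (cis (- s) * z)) = F (cis (u - s) * z)" for z
        by (simp_all add: cis_mult flip: mult.assoc)
      then show ?thesis
        using functional_second_difference[OF bergman_space_rotate[OF F'(1), of u] k Z(1), of s]
          bergman_norm_rotate[OF bergman_spaceD(3)[OF F'(1)], of p u] F'(2)
        by (simp add: \<psi>_def)
    qed
    from zygmund_order_gt_2_affine[OF this \<beta>, of 0] have eq: "\<psi> s + \<psi> (- s) = 2 * \<psi> 0" for s
      by simp
    \<comment> \<open>The constant 0 with the exponent 1 brings this identity into the range of
      \<open>near\<close>; the resulting delta is 0, so the distance vanishes.\<close>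
    have S: "2 * M - 0 * \<bar>s\<bar> powr 1 \<le> Re (\<psi> s) + Re (\<psi> (- s))" for s
      using arg_cong[OF eq[of s], of Re] by (simp add: \<psi>_def M_def)
    have "M * (1 - 0) \<le> Re (bergman_functional \<alpha> k (Fn n))"
      using near[OF S[unfolded \<psi>_def], of n] n by simp
    note nr = this[unfolded M_def] and M' = M[unfolded M_def]
    show ?thesis
    proof (cases "p < 2")
      case True
      have "(p - 1)\<^sup>2 * (N n)\<^sup>2 \<le> 0"
        using distance_lt_2[OF F k M' G nr True] by (simp add: N_def)
      moreover have "0 < (p - 1)\<^sup>2" using p1 by simp
      ultimately show ?thesis by (simp add: mult_le_0_iff)
    next
      case False
      then have "2 < p" using assms(2) by simp
      then have "(N n / 2) powr p \<le> 0"
        using distance_gt_2[OF F k M' G nr] by (simp add: N_def)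
      then show ?thesis by simp
    qed
  qed
  have big: "N \<in> O(\<lambda>n. real n powr (- \<beta> / d))" if d: "0 < d"
    and "0 < \<beta> \<Longrightarrow> \<beta> \<le> 2 \<Longrightarrow> \<exists>c. \<forall>n\<ge>1. N n \<le> c * real n powr (- \<beta> / d)" for d
  proof -
    have "\<exists>c. \<forall>n\<ge>1. N n \<le> c * real n powr (- \<beta> / d)"
    proof -
      consider "\<beta> \<le> 0" | "0 < \<beta>" "\<beta> \<le> 2" | "2 < \<beta>" by linarith
      then show ?thesis
      proof cases
        case 1
        have "N n \<le> 2 * real n powr (- \<beta> / d)" if "1 \<le> n" for n
        proof -
          have "1 \<le> real n powr (- \<beta> / d)" using 1 d that
            by (intro ge_one_powr_ge_zero) (auto simp: divide_nonpos_pos)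
          then show ?thesis using N2[of n] by linarith
        qed
        then show ?thesis by blast
      next
        case 2
        then show ?thesis using that by blast
      next
        case 3
        then show ?thesis using rigid by (intro exI[of _ 0]) auto
      qed
    qed
    then obtain c where "\<And>n. 1 \<le> n \<Longrightarrow> N n \<le> c * real n powr (- \<beta> / d)" by blast
    then show ?thesis
      using N0 by (intro bigoI[of _ c] eventually_sequentiallyI[of 1]) auto
  qed
  have "N \<in> O(\<lambda>n. real n powr (- \<beta> / 4))" if p2: "p < 2"
  proof (rule big)
    assume "0 < \<beta>" "\<beta> \<le> 2"
    then show "\<exists>c. \<forall>n\<ge>1. N n \<le> c * real n powr (- \<beta> / 4)"
      using i[OF p2] ii[OF p2] by (cases "\<beta> = 2") (blast, force)
  qed simp
  moreover have "N \<in> O(\<lambda>n. real n powr (- \<beta> / p\<^sup>2))" if p2: "2 < p"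
  proof (rule big)
    assume "0 < \<beta>" "\<beta> \<le> 2"
    then show "\<exists>c. \<forall>n\<ge>1. N n \<le> c * real n powr (- \<beta> / p\<^sup>2)"
      using iii[OF p2] by blast
  qed (use p1 in simp)
  ultimately show ?thesis
    using i ii iii unfolding nz N_def[abs_def] by blast
qed

end
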